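(* Let $f$ be an entire function of finite order $\rho(f)$. Let $\varepsilon>0$ and suppose that $$\operatorname{logarea}\left\{ z\in\Delta : \left|\frac{zf'(z)}{f(z)}\right| < |z|^{\rho(f)/2+\varepsilon}\ \text{ or }\ |f(z)| < (1+\varepsilon)|z| \right\} <\infty.$$ Then $$\operatorname{logarea}(\Delta\setminus I(f))<\infty.$$ In particular, $\operatorname{area} I(f)>0$. If, in addition, $F(f)$ does not have a multiply connected component, then $$\operatorname{logarea}(\Delta\setminus (I(f)\cap J(f)))<\infty$$ and thus $\operatorname{area}(I(f)\cap J(f))>0$.
   Context: Throughout, $f$ is a non-linear entire function and $f^n$ denotes its $n$-th iterate. The Fatou set $F(f)$ is the set of all $z\in\mathbb{C}$ at which the iterates $f^n$ form a normal family (i.e. they are normal in some neighborhood of $z$); the Julia set is $J(f)=\mathbb{C}\setminus F(f)$; the escaping set $I(f)$ is the set of all $z\in\mathbb{C}$ with $f^n(z)\to\infty$ as $n\to\infty$. A component of $F(f)$ is a connected component; it is multiply connected if it is not simply connected. The order of $f$ is $\rho(f)=\limsup_{r\to\infty}\frac{\log\log M(r,f)}{\log r}$, where $M(r,f)=\max_{|z|=r}|f(z)|$. $\operatorname{area} A$ is the two-dimensional Lebesgue measure of a measurable set $A\subset\mathbb{C}$, the logarithmic area is $\operatorname{logarea} A=\int_A \frac{dx\,dy}{|z|^2}$ (with $z=x+iy$), and $\Delta=\{z\in\mathbb{C}: |z|\ge 1\}$. *)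

theory Defs
  imports "HOL-Complex_Analysis.Complex_Analysis"
begin

definition entire :: "(complex \<Rightarrow> complex) \<Rightarrow> bool" where
  "entire f \<longleftrightarrow> f holomorphic_on UNIV"

text \<open>Constant functions count as (degenerate) linear ones.\<close>

definition linear_fun :: "(complex \<Rightarrow> complex) \<Rightarrow> bool" where
  "linear_fun f \<longleftrightarrow> (\<exists>a b. \<forall>z. f z = a * z + b)"

text \<open>The supremum is attained, and hence is a maximum, for continuous \<open>f\<close> and \<open>r \<ge> 0\<close>.\<close>

definition max_modulus :: "real \<Rightarrow> (complex \<Rightarrow> complex) \<Rightarrow> real" where
  "max_modulus r f = (SUP z\<in>sphere 0 r. norm (f z))"

text \<open>For non-constant entire \<open>f\<close>, \<open>max_modulus r f\<close> tends to infinity, so that the values of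
  \<open>ln\<close> at non-positive arguments do not affect the upper limit.\<close>

definition growth_order :: "(complex \<Rightarrow> complex) \<Rightarrow> ereal" where
  "growth_order f = Limsup at_top (\<lambda>r. ereal (ln (ln (max_modulus r f)) / ln r))"

text \<open>Normality on a domain \<open>U\<close> (open and connected) of a family of holomorphic functions, in the
  sense of the spherical metric: the constant \<open>\<infinity>\<close> is admitted as a locally uniform limit.\<close>

definition normal_family_on :: "complex set \<Rightarrow> (complex \<Rightarrow> complex) set \<Rightarrow> bool" where
  "normal_family_on U \<F> \<longleftrightarrow>
     (\<forall>h::nat \<Rightarrow> complex \<Rightarrow> complex. range h \<subseteq> \<F> \<longrightarrow>
       (\<exists>k::nat \<Rightarrow> nat. strict_mono k \<and>
         ((\<exists>g. \<forall>K. compact K \<and> K \<subseteq> U \<longrightarrow> uniform_limit K (\<lambda>n. h (k n)) g sequentially) \<or>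
          (\<forall>K. compact K \<and> K \<subseteq> U \<longrightarrow>
             (\<forall>B::real. \<forall>\<^sub>F n in sequentially. \<forall>z\<in>K. norm (h (k n) z) > B)))))"

definition Fatou :: "(complex \<Rightarrow> complex) \<Rightarrow> complex set" where
  "Fatou f = {z. \<exists>U. open U \<and> connected U \<and> z \<in> U \<and> normal_family_on U (range (\<lambda>n. f ^^ n))}"

definition Julia :: "(complex \<Rightarrow> complex) \<Rightarrow> complex set" where
  "Julia f = - Fatou f"

definition escaping :: "(complex \<Rightarrow> complex) \<Rightarrow> complex set" where
  "escaping f = {z. filterlim (\<lambda>n. (f ^^ n) z) at_infinity sequentially}"

definition area :: "complex set \<Rightarrow> ennreal" where
  "area A = emeasure lebesgue A"

definition logarea :: "complex set \<Rightarrow> ennreal" where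
  "logarea A = (\<integral>\<^sup>+z\<in>A. ennreal (1 / (norm z)\<^sup>2) \<partial>lebesgue)"

definition outer_region :: "complex set" where
  "outer_region = {z. norm z \<ge> 1}"

end

theory Submission
  imports Defs
begin

text \<open>
  Let \<open>E\<close> be the exceptional set whose logarithmic area is assumed to be finite. In the coordinate
  \<open>log z\<close>, in which the logarithmic area is ordinary area, \<open>f\<close> acts with derivative
  \<open>z f'(z) / f(z)\<close>. Hence off \<open>E\<close> it multiplies logarithmic area by at least
  \<open>|z| powr (\<rho> + 2 \<epsilon>)\<close>, whereas, \<open>f\<close> having order \<open>\<rho>\<close>, a value \<open>w\<close> has only
  \<open>O(r powr (\<rho> + \<epsilon>))\<close> preimages of modulus at most \<open>r\<close>, uniformly in \<open>w\<close>. Summing over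
  dyadic annuli, one finds that for large \<open>R\<close> the part of \<open>f\<inverse>(B)\<close> that lies in \<open>|z| \<ge> R\<close> and off
  \<open>E\<close> has at most half the logarithmic area of \<open>B\<close> (\<open>logarea_pullback_le_half\<close>). Therefore the set
  of points of modulus at least \<open>R\<close> whose orbit ever enters \<open>E\<close> has logarithmic area at most
  \<open>1 + 1/2 + 1/4 + \<dots>\<close> times that of \<open>E\<close>. All other points \<open>z\<close> with \<open>|z| \<ge> R\<close> satisfy
  \<open>|f\<^sup>n z| \<ge> (1 + \<epsilon>)\<^sup>n |z|\<close> and so escape. This is the first assertion; the positivity of the area
  follows because the logarithmic area of the whole region \<open>|z| \<ge> 1\<close> is infinite.

  For the second assertion, consider a point \<open>z\<close> whose orbit avoids \<open>E\<close> and stays in \<open>|z| \<ge> R\<close>.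
  By the chain rule \<open>|(f\<^sup>n)'(z)| / |f\<^sup>n z|\<close> tends to infinity. If \<open>z\<close> were in the Fatou set, so would
  be a disc \<open>D\<close> about \<open>z\<close> and all its images \<open>f\<^sup>n(D)\<close>. For a point \<open>p\<close> of the Julia set,
  \<open>log (f\<^sup>n - p)\<close> is then a holomorphic function on \<open>D\<close> whose derivative at \<open>z\<close> is large, and by
  Bloch's theorem its image contains a disc of radius greater than \<open>\<pi>\<close>. Exponentiating, \<open>f\<^sup>n(D)\<close>
  contains a circle centred at \<open>p\<close> (\<open>image_contains_circle_around_omitted_value\<close>). The Fatou component
  containing that circle surrounds \<open>p\<close> and is multiply connected.

  The Julia set is non-empty because otherwise the escaping set, which is open and closed relative to
  the Fatou set, would be the whole plane; but a non-linear entire function has a point of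
  period at most two (\<open>exists_period_two_point\<close>).
\<close>

section \<open>Counting preimages of a function of finite order\<close>

text \<open>This is the part of Jensen's inequality that counts distinct zeros. Dividing \<open>g\<close> by \<open>z - a\<close> for a
  zero \<open>a\<close> lowers the bound on the circle of radius \<open>3 r\<close>, where \<open>|z - a| \<ge> 2 r\<close>, by the factor
  \<open>2 r\<close>, but lowers the value at the origin only by \<open>|a| \<le> r\<close>: each zero gains a factor \<open>2\<close>.\<close>

lemma zero_count_bound:
  assumes "finite A" "g holomorphic_on UNIV" "A \<subseteq> cball 0 r" "\<And>z. z \<in> A \<Longrightarrow> g z = 0" "0 < r"
    and "\<And>z. z \<in> sphere 0 (3 * r) \<Longrightarrow> norm (g z) \<le> B"
  shows "norm (g 0) * 2 ^ card A \<le> B"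
  using assms
proof (induction A arbitrary: g B rule: finite_induct)
  case empty
  have "norm (g 0) \<le> B"
  proof (rule maximum_modulus_frontier[where f = g and \<xi> = 0 and S = "ball 0 (3 * r)"])
    show "continuous_on (closure (ball 0 (3 * r))) g"
      using empty.prems(1) by (meson holomorphic_on_imp_continuous_on continuous_on_subset subset_UNIV)
    show "norm (g z) \<le> B" if "z \<in> frontier (ball 0 (3 * r))" for z
      using that empty.prems by (simp add: frontier_ball)
  qed (use empty.prems in \<open>auto intro: holomorphic_on_subset\<close>)
  then show ?case by simp
next
  case (insert a A)
  define h where "h z = (if z = a then deriv g a else g z / (z - a))" for z
  have ga: "g a = 0" using insert.prems by simp
  have "(\<lambda>z. if z = a then deriv g a else g z / (z - a) - g a / (z - a)) holomorphic_on UNIV"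
    using insert.prems(1) by (intro pole_theorem) auto
  then have hol: "h holomorphic_on UNIV"
    unfolding h_def[abs_def] ga by (simp cong: if_cong)
  have gh: "g z = (z - a) * h z" for z
    by (simp add: h_def ga)
  have bnd: "norm (h z) \<le> B / (2 * r)" if "z \<in> sphere 0 (3 * r)" for z
  proof -
    have "2 * r \<le> norm (z - a)"
      using that insert.prems(2) norm_triangle_ineq2[of z a] by simp
    then have "2 * r * norm (h z) \<le> norm (z - a) * norm (h z)"
      by (simp add: mult_right_mono)
    also have "\<dots> = norm (g z)" by (simp add: gh norm_mult)
    also have "\<dots> \<le> B" using insert.prems that by blast
    finally show ?thesis using insert.prems(4) by (simp add: field_simps)
  qed
  have "norm (h 0) * 2 ^ card A \<le> B / (2 * r)"
  proof (rule insert.IH)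
    show "h z = 0" if "z \<in> A" for z
      using that insert.prems(3)[of z] insert.hyps by (auto simp: h_def)
  qed (use insert.prems hol bnd in auto)
  then have "2 * r * (norm (h 0) * 2 ^ card A) \<le> B"
    using insert.prems(4) by (simp add: field_simps)
  moreover have "norm a \<le> r" using insert.prems(2) by simp
  then have "norm a * (2 * (norm (h 0) * 2 ^ card A)) \<le> r * (2 * (norm (h 0) * 2 ^ card A))"
    by (intro mult_right_mono) auto
  ultimately show ?case
    using insert.hyps by (simp add: gh[of 0] norm_mult mult_ac)
qed

lemma growth_order_less_imp_bound:
  assumes "entire f" "growth_order f < ereal a"
  shows "\<forall>\<^sub>F r in at_top. \<forall>z\<in>sphere 0 r. norm (f z) \<le> exp (r powr a)"
proof -
  have cont: "continuous_on S f" for S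
    using assms(1) unfolding entire_def
    by (meson continuous_on_subset holomorphic_on_imp_continuous_on subset_UNIV)
  have "\<forall>\<^sub>F r in at_top. ereal (ln (ln (max_modulus r f)) / ln r) < ereal a"
    using Limsup_lessD assms(2) unfolding growth_order_def by blast
  then show ?thesis
    using eventually_gt_at_top[of 1]
  proof eventually_elim
    case (elim r)
    let ?M = "max_modulus r f"
    \<comment> \<open>If \<open>?M \<le> 1\<close>, the iterated logarithm carries no information, but the bound is trivial.\<close>
    have M: "?M \<le> exp (r powr a)"
    proof (cases "?M \<le> 1")
      case True
      also have "1 \<le> exp (r powr a)" by simp
      finally show ?thesis .
    next
      case False
      then have "ln ?M > 0" by simp
      moreover have "ln (ln ?M) < a * ln r"
        using elim by (simp add: field_simps)
      ultimately have "ln ?M < exp (a * ln r)"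
        by (metis exp_less_cancel_iff exp_ln)
      also have "\<dots> = r powr a" using elim by (simp add: powr_def)
      finally show ?thesis
        using False by (metis exp_le_cancel_iff exp_ln less_le_not_le linorder_not_le order_less_trans zero_less_one)
    qed
    show ?case
    proof
      fix z assume z: "z \<in> sphere (0::complex) r"
      have "bdd_above ((\<lambda>z. norm (f z)) ` sphere 0 r)"
        by (intro bounded_imp_bdd_above compact_imp_bounded compact_continuous_image
              continuous_intros cont) simp
      then have "norm (f z) \<le> ?M"
        unfolding max_modulus_def using z by (intro cSUP_upper)
      with M show "norm (f z) \<le> exp (r powr a)" by simp
    qed
  qed
qed

text \<open>A negative order would bound \<open>f\<close>, against Liouville's theorem. Non-negativity of the order makes
  the additive constants in the count of preimages negligible against a positive power of \<open>r\<close>.\<close>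

lemma growth_order_nonneg:
  assumes "entire f" "\<not> f constant_on UNIV"
  shows "0 \<le> growth_order f"
proof (rule ccontr)
  assume "\<not> 0 \<le> growth_order f"
  then have "growth_order f < ereal 0" by (simp add: zero_ereal_def)
  then obtain R where R: "\<And>r z. r \<ge> R \<Longrightarrow> z \<in> sphere 0 r \<Longrightarrow> norm (f z) \<le> exp (r powr 0)"
    using growth_order_less_imp_bound[OF assms(1)] unfolding eventually_at_top_linorder by blast
  have "continuous_on (cball 0 R) f"
    using assms(1) unfolding entire_def
    by (meson continuous_on_subset holomorphic_on_imp_continuous_on subset_UNIV)
  then have "bounded (f ` cball 0 R)"
    by (intro compact_imp_bounded compact_continuous_image) auto
  then obtain B where B: "\<And>z. norm z \<le> R \<Longrightarrow> norm (f z) \<le> B"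
    unfolding bounded_iff by (metis imageI mem_cball_0)
  have "norm (f z) \<le> max B (exp 1)" for z
  proof (cases "norm z \<le> R")
    case False
    then have "norm (f z) \<le> exp (norm z powr 0)" using R[of "norm z" z] by simp
    also have "\<dots> \<le> exp 1" by (simp add: powr_def)
    finally show ?thesis by simp
  qed (use B in fastforce)
  then have "bounded (range f)" unfolding bounded_iff by blast
  then show False
    using Liouville_theorem assms unfolding entire_def by blast
qed

text \<open>The count is applied to \<open>f - w\<close>. It is uniform in \<open>w\<close> because \<open>w\<close> enters both the bound
  \<open>M(3 r) + |w|\<close> and the lower bound \<open>|w| / 2\<close> for the value at the origin, so that their ratio
  does not grow with \<open>w\<close>.\<close>

lemma preimage_count_bound:
  assumes "entire f" "growth_order f < ereal a" "0 < a"
  obtains C R where "0 < C" "1 \<le> R"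
    "\<And>r w A. \<lbrakk>R \<le> r; R \<le> norm w; finite A; A \<subseteq> cball 0 r; f ` A \<subseteq> {w}\<rbrakk>
       \<Longrightarrow> real (card A) \<le> C * r powr a"
proof -
  obtain R0 where R0: "\<And>r z. r \<ge> R0 \<Longrightarrow> z \<in> sphere 0 r \<Longrightarrow> norm (f z) \<le> exp (r powr a)"
    using growth_order_less_imp_bound[OF assms(1,2)] unfolding eventually_at_top_linorder by blast
  define R where "R = Max {1, R0, 2 * norm (f 0)}"
  have R: "R \<ge> 1" "R \<ge> R0" "R \<ge> 2 * norm (f 0)" by (auto simp: R_def)
  have "real (card A) \<le> (2 + 2 * 3 powr a) * r powr a"
    if r: "R \<le> r" and w: "R \<le> norm w" and A: "finite A" "A \<subseteq> cball 0 r" "f ` A \<subseteq> {w}" for r w A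
  proof -
    define X where "X = (3 * r) powr a"
    have "norm (f 0 - w) * 2 ^ card A \<le> exp X + norm w"
    proof (rule zero_count_bound[OF A(1) _ A(2)])
      show "(\<lambda>z. f z - w) holomorphic_on UNIV"
        using assms(1) unfolding entire_def by (intro holomorphic_intros)
      fix z assume "z \<in> sphere (0::complex) (3 * r)"
      then have "norm (f z) \<le> exp X"
        unfolding X_def using R r by (intro R0) auto
      then show "norm (f z - w) \<le> exp X + norm w"
        using norm_triangle_ineq4[of "f z" w] by simp
    qed (use A R r in auto)
    moreover have "norm w / 2 \<le> norm (f 0 - w)"
      using norm_triangle_ineq2[of w "f 0"] R w by (simp add: norm_minus_commute)
    then have "norm w / 2 * 2 ^ card A \<le> norm (f 0 - w) * 2 ^ card A"
      by (intro mult_right_mono) auto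
    moreover have "exp X \<le> norm w * exp X" "norm w \<le> norm w * exp X"
      using R w mult_right_mono[of 1 "norm w" "exp X"] mult_left_mono[of 1 "exp X" "norm w"]
      by (simp_all del: exp_ge_zero add: X_def)
    ultimately have "norm w * 2 ^ card A \<le> norm w * (4 * exp X)" by linarith
    then have "(2::real) ^ card A \<le> 4 * exp X"
      using R w by (subst (asm) mult_le_cancel_left_pos) auto
    then have "ln ((2::real) ^ card A) \<le> ln (4 * exp X)"
      by simp
    also have "\<dots> = ln (2 ^ 2) + X" by (simp add: ln_mult)
    also have "ln ((2::real) ^ 2) = 2 * ln 2" by (subst ln_realpow) auto
    finally have "real (card A) * ln 2 \<le> 2 * ln 2 + X" by (simp add: ln_realpow)
    moreover have ln2: "1 / 2 \<le> ln (2::real)"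
      using ln_le_minus_one[of "1 / 2 :: real"] by (simp add: ln_div)
    moreover have "X * (1 / 2) \<le> X * ln 2"
      using ln2 by (intro mult_left_mono) (auto simp: X_def)
    ultimately have "real (card A) * ln 2 \<le> (2 + 2 * X) * ln 2" by (simp add: algebra_simps)
    then have "real (card A) \<le> 2 + 2 * X" using ln2 by simp
    moreover have "X = 3 powr a * r powr a" using R r by (simp add: X_def powr_mult)
    moreover have "1 \<le> r powr a" using R r assms(3) by (simp add: ge_one_powr_ge_zero)
    ultimately show ?thesis by (simp add: algebra_simps)
  qed
  then show ?thesis
    using that[of "2 + 2 * 3 powr a" R] R by (simp add: add_pos_pos)
qed

section \<open>Area and injective holomorphic maps\<close>

text \<open>The change of variables formula is stated for \<open>real ^ 'n\<close>. It is carried over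
  to the complex plane along this isometry.\<close>

definition complex_of_vec :: "real ^ 2 \<Rightarrow> complex" where
  "complex_of_vec v = Complex (v $ 1) (v $ 2)"

definition vec_of_complex :: "complex \<Rightarrow> real ^ 2" where
  "vec_of_complex z = (\<chi> i. if i = 1 then Re z else Im z)"

lemma vec_of_complex_inverse [simp]: "complex_of_vec (vec_of_complex z) = z"
  by (simp add: complex_of_vec_def vec_of_complex_def)

lemma complex_of_vec_inverse [simp]: "vec_of_complex (complex_of_vec v) = v"
  by (simp add: complex_of_vec_def vec_of_complex_def vec_eq_iff forall_2)

lemma bounded_linear_complex_of_vec: "bounded_linear complex_of_vec"
  by (rule linear_conv_bounded_linear[THEN iffD1], rule linearI)
     (auto simp: complex_of_vec_def complex_eq_iff)

lemma bounded_linear_vec_of_complex: "bounded_linear vec_of_complex"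
  by (rule linear_conv_bounded_linear[THEN iffD1], rule linearI)
     (auto simp: vec_of_complex_def vec_eq_iff)

lemma borel_measurable_complex_of_vec [measurable]: "complex_of_vec \<in> borel_measurable borel"
  by (intro borel_measurable_continuous_onI linear_continuous_on bounded_linear_complex_of_vec)

lemma lborel_complex_eq_distr: "lborel = distr lborel borel complex_of_vec"
proof (rule lborel_eqI)
  fix l u :: complex
  assume le: "\<And>b. b \<in> Basis \<Longrightarrow> l \<bullet> b \<le> u \<bullet> b"
  have "complex_of_vec -` box l u = box (vec_of_complex l) (vec_of_complex u)"
    by (auto simp: in_box_complex_iff complex_of_vec_def vec_of_complex_def mem_box_cart forall_2)
  moreover have "emeasure lborel (box (vec_of_complex l) (vec_of_complex u)) =
      ennreal (prod ((\<bullet>) (vec_of_complex u - vec_of_complex l)) Basis)"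
    using le[of 1] le[of \<i>]
    by (intro emeasure_lborel_box)
       (auto simp: Basis_vec_def inner_axis vec_of_complex_def Basis_complex_def)
  moreover have "prod ((\<bullet>) (vec_of_complex u - vec_of_complex l)) Basis = prod ((\<bullet>) (u - l)) Basis"
    by (simp add: prod.reindex inj_on_def Basis_complex_def Basis_vec_def inner_axis vec_of_complex_def
        UNIV_2 axis_eq_axis)
  ultimately show "emeasure (distr lborel borel complex_of_vec) (box l u) = ennreal (prod ((\<bullet>) (u - l)) Basis)"
    by (simp add: emeasure_distr)
qed simp

text \<open>Multiplication by a complex number \<open>c\<close> has real Jacobian determinant \<open>|c|\<^sup>2\<close>. Boundedness of \<open>S\<close>
  makes the integral finite, which the integrability hypothesis of the real formula requires.\<close>

lemma emeasure_image_holomorphic_inj: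
  assumes hol: "f holomorphic_on UNIV" and S: "S \<in> sets borel" "bounded S" "inj_on f S"
    and fS: "f ` S \<in> sets borel"
  shows "emeasure lborel (f ` S) = (\<integral>\<^sup>+z\<in>S. ennreal ((norm (deriv f z))\<^sup>2) \<partial>lborel)"
proof -
  define T where "T = complex_of_vec -` S"
  define g where "g = vec_of_complex \<circ> f \<circ> complex_of_vec"
  define g' where "g' v = vec_of_complex \<circ> (\<lambda>h. deriv f (complex_of_vec v) * h) \<circ> complex_of_vec" for v
  define J where "J v = (norm (deriv f (complex_of_vec v)))\<^sup>2" for v
  have cderiv: "continuous_on A (deriv f)" for A
    using hol by (meson continuous_on_subset holomorphic_deriv holomorphic_on_imp_continuous_on
        open_UNIV subset_UNIV)
  have [measurable]: "deriv f \<in> borel_measurable borel"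
    by (intro borel_measurable_continuous_onI cderiv)
  have [measurable]: "S \<in> sets borel" by fact
  have [measurable]: "T \<in> sets borel"
    using measurable_sets[OF borel_measurable_complex_of_vec \<open>S \<in> sets borel\<close>] by (simp add: T_def)
  have der: "(g has_derivative g' v) (at v within T)" for v
  proof -
    have "(f has_field_derivative deriv f (complex_of_vec v)) (at (complex_of_vec v))"
      using hol by (simp add: holomorphic_derivI)
    then have "(f has_derivative (\<lambda>h. deriv f (complex_of_vec v) * h))
        (at (complex_of_vec v) within complex_of_vec ` T)"
      by (simp add: has_field_derivative_def has_derivative_at_withinI)
    from diff_chain_within[OF bounded_linear_imp_has_derivative[OF bounded_linear_complex_of_vec] this]
    have "(f \<circ> complex_of_vec has_derivative (\<lambda>h. deriv f (complex_of_vec v) * h) \<circ> complex_of_vec)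
        (at v within T)" .
    from diff_chain_within[OF this bounded_linear_imp_has_derivative[OF bounded_linear_vec_of_complex]]
    show ?thesis unfolding g_def g'_def by (simp only: comp_assoc)
  qed
  have det: "\<bar>det (matrix (g' v))\<bar> = J v" for v
    by (simp add: J_def det_2 matrix_def g'_def vec_of_complex_def complex_of_vec_def axis_def
        cmod_power2 flip: power2_eq_square)
  have inj: "inj_on g T"
    using S(3) unfolding inj_on_def g_def T_def
    by (metis comp_apply complex_of_vec_inverse vec_of_complex_inverse vimageE)
  have gT: "g ` T = complex_of_vec -` (f ` S)"
  proof (intro equalityI subsetI)
    fix v assume "v \<in> complex_of_vec -` (f ` S)"
    then obtain z where "z \<in> S" "complex_of_vec v = f z" by auto
    then have "vec_of_complex z \<in> T" "v = g (vec_of_complex z)"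
      using complex_of_vec_inverse[of v] by (auto simp: T_def g_def)
    then show "v \<in> g ` T" by blast
  qed (auto simp: T_def g_def)
  obtain K where K: "\<And>z. z \<in> S \<Longrightarrow> norm (deriv f z) \<le> K"
  proof -
    have "bounded (deriv f ` closure S)"
      using S(2) by (intro compact_imp_bounded compact_continuous_image cderiv) simp
    then show ?thesis
      using that closure_subset unfolding bounded_iff by blast
  qed
  have eS: "emeasure lborel S < \<infinity>"
    using S emeasure_bounded_finite by blast
  have *: "(\<integral>\<^sup>+v\<in>T. ennreal (J v) \<partial>lborel) = (\<integral>\<^sup>+z\<in>S. ennreal ((norm (deriv f z))\<^sup>2) \<partial>lborel)"
  proof -
    have "(\<integral>\<^sup>+z\<in>S. ennreal ((norm (deriv f z))\<^sup>2) \<partial>lborel) =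
        (\<integral>\<^sup>+z\<in>S. ennreal ((norm (deriv f z))\<^sup>2) \<partial>distr lborel borel complex_of_vec)"
      by (simp flip: lborel_complex_eq_distr)
    also have "\<dots> = (\<integral>\<^sup>+v\<in>T. ennreal (J v) \<partial>lborel)"
      unfolding J_def T_def
      by (subst nn_integral_distr) (auto intro!: nn_integral_cong split: split_indicator)
    finally show ?thesis by simp
  qed
  have "(\<integral>\<^sup>+z\<in>S. ennreal ((norm (deriv f z))\<^sup>2) \<partial>lborel) \<le> (\<integral>\<^sup>+z. ennreal (K\<^sup>2) * indicator S z \<partial>lborel)"
    by (intro nn_integral_mono) (auto split: split_indicator intro!: power_mono ennreal_leI K)
  also have "\<dots> < \<infinity>"
    using eS by (simp add: nn_integral_cmult_indicator ennreal_mult_less_top)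
  finally have fin: "(\<integral>\<^sup>+v\<in>T. ennreal (J v) \<partial>lborel) < \<infinity>"
    by (simp add: *)
  have [measurable]: "J \<in> borel_measurable borel" unfolding J_def[abs_def] by measurable
  have Jint: "(\<integral>\<^sup>+v. ennreal (J v * indicator T v) \<partial>lborel) = (\<integral>\<^sup>+v\<in>T. ennreal (J v) \<partial>lborel)"
    by (intro nn_integral_cong) (auto split: split_indicator)
  with fin obtain r where r: "0 \<le> r" "(\<integral>\<^sup>+v. ennreal (J v * indicator T v) \<partial>lborel) = ennreal r"
    by (metis infinity_ennreal_def ennreal_cases less_irrefl)
  have "((\<lambda>v. J v * indicator T v) has_integral r) UNIV"
    using r by (intro nn_integral_has_integral) (auto simp: J_def)
  also have "(\<lambda>v. J v * indicator T v) = (\<lambda>v. if v \<in> T then J v else 0)"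
    by auto
  finally have hi: "(J has_integral r) T"
    by (simp add: has_integral_restrict_UNIV)
  have Tl: "T \<in> sets lebesgue" by simp
  have "g ` T \<in> lmeasurable"
    using measurable_differentiable_image_eq[OF Tl der inj] hi by (auto simp: det)
  moreover have "measure lebesgue (g ` T) = r"
    using measure_differentiable_image_eq[OF Tl der inj] hi by (auto simp: det integral_unique)
  ultimately have "emeasure lebesgue (g ` T) = ennreal r"
    by (metis emeasure_eq_ennreal_measure fmeasurableD2)
  moreover have "emeasure lborel (f ` S) = emeasure lborel (g ` T)"
    using fS by (subst lborel_complex_eq_distr) (simp add: emeasure_distr gT)
  moreover have "g ` T \<in> sets borel"
    unfolding gT using measurable_sets[OF borel_measurable_complex_of_vec fS] by simp
  ultimately show ?thesis using r(2) Jint * by simp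
qed

text \<open>The image is the preimage of \<open>S\<close> under the inverse function, which is holomorphic on the open set
  \<open>f ` U\<close>.\<close>

lemma borel_image_holomorphic_inj:
  assumes "f holomorphic_on U" "open U" "inj_on f U" "S \<subseteq> U" "S \<in> sets borel"
  shows "f ` S \<in> sets borel"
proof -
  obtain g where g: "g holomorphic_on f ` U" "\<And>z. z \<in> U \<Longrightarrow> g (f z) = z"
    using holomorphic_has_inverse[OF assms(1-3)] by metis
  have op: "open (f ` U)" using open_mapping_thm3[OF assms(1-3)] .
  have "g \<in> borel_measurable (restrict_space borel (f ` U))"
    using g(1) by (intro borel_measurable_continuous_on_restrict holomorphic_on_imp_continuous_on)
  then have "g -` S \<inter> space (restrict_space borel (f ` U)) \<in> sets (restrict_space borel (f ` U))"
    using assms(5) by (rule measurable_sets)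
  then have "g -` S \<inter> f ` U \<in> sets borel"
    using op by (simp add: space_restrict_space sets_restrict_space_iff)
  moreover have "g -` S \<inter> f ` U = f ` S"
    using g(2) assms(4) by (auto simp: image_iff)
  ultimately show ?thesis by simp
qed

text \<open>The area formula, applied to the sets \<open>S \<inter> f -` X\<close>, says that the push-forward under \<open>f\<close> of the
  measure with density \<open>|f'|\<^sup>2\<close> on \<open>S\<close> is Lebesgue measure on \<open>f ` S\<close>. Integrating \<open>u\<close> against both
  measures gives the substitution rule.\<close>

lemma nn_integral_substitution_holomorphic:
  assumes hol: "f holomorphic_on UNIV" and U: "open U" "inj_on f U"
    and S: "S \<subseteq> U" "S \<in> sets borel" "bounded S" and u: "u \<in> borel_measurable borel"
  shows "(\<integral>\<^sup>+z\<in>S. ennreal ((norm (deriv f z))\<^sup>2) * u (f z) \<partial>lborel) = (\<integral>\<^sup>+w\<in>f ` S. u w \<partial>lborel)"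
proof -
  have holU: "f holomorphic_on U" using hol holomorphic_on_subset by blast
  have im: "f ` X \<in> sets borel" if "X \<subseteq> S" "X \<in> sets borel" for X
    using borel_image_holomorphic_inj[OF holU U] S that by auto
  have [measurable]: "f \<in> borel_measurable borel" "deriv f \<in> borel_measurable borel"
    "S \<in> sets borel" "f ` S \<in> sets borel" "u \<in> borel_measurable borel"
    using hol S im u
    by (auto intro!: borel_measurable_continuous_onI holomorphic_on_imp_continuous_on holomorphic_deriv)
  define D where "D z = ennreal ((norm (deriv f z))\<^sup>2) * indicator S z" for z
  have [measurable]: "D \<in> borel_measurable borel" unfolding D_def[abs_def] by measurable
  have eq: "distr (density lborel D) borel f = density lborel (indicator (f ` S))"
  proof (rule measure_eqI)
    fix X assume "X \<in> sets (distr (density lborel D) borel f)"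
    then have [measurable]: "X \<in> sets borel" by simp
    define Y where "Y = S \<inter> f -` X"
    have Y: "Y \<in> sets borel"
    proof -
      have "f -` X \<inter> space borel \<in> sets borel" by measurable
      then show ?thesis unfolding Y_def by simp
    qed
    have "emeasure (distr (density lborel D) borel f) X = (\<integral>\<^sup>+z. D z * indicator (f -` X) z \<partial>lborel)"
      by (simp add: emeasure_distr emeasure_density measurable_sets[OF \<open>f \<in> borel_measurable borel\<close>, of X, simplified])
    also have "\<dots> = (\<integral>\<^sup>+z\<in>Y. ennreal ((norm (deriv f z))\<^sup>2) \<partial>lborel)"
      unfolding D_def Y_def by (intro nn_integral_cong) (auto split: split_indicator)
    also have "\<dots> = emeasure lborel (f ` Y)"
      using U S Y im[of Y] bounded_subset[of S Y] inj_on_subset[of f U Y]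
      by (intro emeasure_image_holomorphic_inj[symmetric] hol) (auto simp: Y_def)
    also have "f ` Y = f ` S \<inter> X" unfolding Y_def by auto
    also have "emeasure lborel \<dots> = emeasure (density lborel (indicator (f ` S))) X"
      by (simp add: emeasure_density flip: indicator_inter_arith)
    finally show "emeasure (distr (density lborel D) borel f) X = emeasure (density lborel (indicator (f ` S))) X" .
  qed simp
  have "(\<integral>\<^sup>+w\<in>f ` S. u w \<partial>lborel) = (\<integral>\<^sup>+w. u w \<partial>density lborel (indicator (f ` S)))"
    by (simp add: nn_integral_density mult.commute)
  also have "\<dots> = (\<integral>\<^sup>+z. D z * u (f z) \<partial>lborel)"
    unfolding eq[symmetric] by (simp add: nn_integral_distr nn_integral_density)
  also have "\<dots> = (\<integral>\<^sup>+z\<in>S. ennreal ((norm (deriv f z))\<^sup>2) * u (f z) \<partial>lborel)"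
    unfolding D_def by (intro nn_integral_cong) (auto split: split_indicator)
  finally show ?thesis by simp
qed

lemma countable_injective_cover:
  assumes "f holomorphic_on UNIV"
  obtains V :: "nat \<Rightarrow> complex set" where "\<And>i. open (V i)" "\<And>i. inj_on f (V i)"
    "{z. deriv f z \<noteq> 0} \<subseteq> (\<Union>i. V i)"
proof -
  define \<V> where "\<V> = {U. open U \<and> inj_on f U}"
  obtain \<V>' where V': "\<V>' \<subseteq> \<V>" "countable \<V>'" "\<Union>\<V>' = \<Union>\<V>"
    using Lindelof[of \<V>] by (auto simp: \<V>_def)
  have cover: "{z. deriv f z \<noteq> 0} \<subseteq> \<Union>\<V>"
  proof
    fix z assume "z \<in> {z. deriv f z \<noteq> 0}"
    then obtain r where "r > 0" "inj_on f (ball z r)"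
      using has_complex_derivative_locally_injective[OF assms, of z] by auto
    then show "z \<in> \<Union>\<V>" unfolding \<V>_def by (auto intro!: exI[of _ "ball z r"])
  qed
  have "{} \<in> \<V>" by (simp add: \<V>_def)
  define V where "V = from_nat_into (insert {} \<V>')"
  have ran: "range V = insert {} \<V>'"
    unfolding V_def using V'(2) by (intro range_from_nat_into) auto
  then have VV: "V i \<in> \<V>" for i
    using V'(1) \<open>{} \<in> \<V>\<close> by (metis insertE rangeI subsetD)
  have UV: "(\<Union>i. V i) = \<Union>\<V>" unfolding ran using V'(3) by simp
  show ?thesis
  proof (rule that)
    show "open (V i)" "inj_on f (V i)" for i
      using VV[of i] by (simp_all add: \<V>_def)
    show "{z. deriv f z \<noteq> 0} \<subseteq> (\<Union>i. V i)" unfolding UV by (rule cover)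
  qed
qed

text \<open>For a map that is not injective, \<open>X\<close> is cut into countably many disjoint pieces on which it is. A
  value \<open>w\<close> lies in the images of no more pieces than it has preimages in \<open>X\<close>.\<close>

lemma nn_integral_substitution_multiplicity_le:
  assumes hol: "f holomorphic_on UNIV" and X: "X \<in> sets borel" "bounded X" "X \<subseteq> {z. deriv f z \<noteq> 0}"
    and B: "B \<in> sets borel" and u: "u \<in> borel_measurable borel"
    and N: "\<And>w A. \<lbrakk>w \<in> B; finite A; A \<subseteq> X; f ` A \<subseteq> {w}\<rbrakk> \<Longrightarrow> real (card A) \<le> N"
  shows "(\<integral>\<^sup>+z\<in>X \<inter> f -` B. ennreal ((norm (deriv f z))\<^sup>2) * u (f z) \<partial>lborel)
           \<le> ennreal N * (\<integral>\<^sup>+w\<in>B. u w \<partial>lborel)"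
proof -
  obtain V :: "nat \<Rightarrow> complex set" where V: "\<And>i. open (V i)" "\<And>i. inj_on f (V i)"
      "{z. deriv f z \<noteq> 0} \<subseteq> (\<Union>i. V i)"
    using countable_injective_cover[OF hol] by blast
  have [measurable]: "f \<in> borel_measurable borel" "deriv f \<in> borel_measurable borel"
    "X \<in> sets borel" "B \<in> sets borel" "u \<in> borel_measurable borel"
    using hol X B u
    by (auto intro!: borel_measurable_continuous_onI holomorphic_on_imp_continuous_on holomorphic_deriv)
  define Y where "Y = X \<inter> f -` B"
  have Y: "Y \<in> sets borel"
    using measurable_sets[OF \<open>f \<in> borel_measurable borel\<close> B] X by (simp add: Y_def)
  define P where "P i = Y \<inter> disjointed V i" for i
  have PV: "P i \<subseteq> V i" for i using disjointed_subset[of V i] by (auto simp: P_def)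
  have "range V \<subseteq> sets borel" using V by auto
  then have "range (disjointed V) \<subseteq> sets borel" by (rule sets.range_disjointed_sets)
  then have Pb [measurable]: "P i \<in> sets borel" for i using Y by (auto simp: P_def)
  have disj: "disjoint_family P"
    using disjoint_family_disjointed[of V] unfolding disjoint_family_on_def P_def by blast
  have UP: "(\<Union>i. P i) = Y"
    using V(3) X(3) UN_disjointed_eq[of V] by (auto simp: P_def Y_def)
  have fP [measurable]: "f ` P i \<in> sets borel" for i
    using borel_image_holomorphic_inj[OF _ V(1,2) PV Pb] hol holomorphic_on_subset by blast
  have fPB: "f ` P i \<subseteq> B" for i by (auto simp: P_def Y_def)
  have count: "(\<Sum>i. indicator (f ` P i) w) \<le> ennreal N * indicator B w" for w
  proof (cases "w \<in> B")
    case False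
    then have "indicator (f ` P i) w = (0::ennreal)" for i
      using fPB[of i] by (auto split: split_indicator)
    then show ?thesis using False by simp
  next
    case True
    have "(\<Sum>i<n. indicator (f ` P i) w) \<le> ennreal N" for n
    proof -
      \<comment> \<open>Choosing a preimage in each piece whose image contains \<open>w\<close> gives distinct points of \<open>X\<close>.\<close>
      define I where "I = {i \<in> {..<n}. w \<in> f ` P i}"
      have "\<forall>i\<in>I. \<exists>z. z \<in> P i \<and> f z = w" by (auto simp: I_def)
      then obtain z where z: "\<And>i. i \<in> I \<Longrightarrow> z i \<in> P i \<and> f (z i) = w" by metis
      have "inj_on z I"
        using disj z unfolding inj_on_def disjoint_family_on_def by (metis IntI UNIV_I empty_iff)
      then have "card (z ` I) = card I" by (rule card_image)
      moreover have "real (card (z ` I)) \<le> N"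
      proof (rule N[OF True])
        show "z ` I \<subseteq> X" using z by (auto simp: P_def Y_def)
      qed (use z in \<open>auto simp: I_def\<close>)
      moreover have "(\<Sum>i<n. indicator (f ` P i) w) = (of_nat (card I) :: ennreal)"
        by (simp add: I_def indicator_def Int_def)
      ultimately show ?thesis by (simp add: ennreal_of_nat_eq_real_of_nat ennreal_leI)
    qed
    then have "(\<Sum>i. indicator (f ` P i) w) \<le> ennreal N" by (intro suminf_le_const) auto
    then show ?thesis using True by simp
  qed
  have "(\<integral>\<^sup>+z\<in>Y. ennreal ((norm (deriv f z))\<^sup>2) * u (f z) \<partial>lborel)
      = (\<Sum>i. \<integral>\<^sup>+z\<in>P i. ennreal ((norm (deriv f z))\<^sup>2) * u (f z) \<partial>lborel)"
    unfolding UP[symmetric] using disj by (intro nn_integral_disjoint_family) auto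
  also have "\<dots> = (\<Sum>i. \<integral>\<^sup>+w\<in>f ` P i. u w \<partial>lborel)"
    by (intro suminf_cong nn_integral_substitution_holomorphic[OF hol V(1,2) PV Pb _ u])
       (auto intro!: bounded_subset[OF X(2)] simp: P_def Y_def)
  also have "\<dots> = (\<integral>\<^sup>+w. (\<Sum>i. u w * indicator (f ` P i) w) \<partial>lborel)"
    by (intro nn_integral_suminf[symmetric]) measurable
  also have "\<dots> \<le> (\<integral>\<^sup>+w. ennreal N * (u w * indicator B w) \<partial>lborel)"
  proof (intro nn_integral_mono)
    fix w
    have "(\<Sum>i. u w * indicator (f ` P i) w) = u w * (\<Sum>i. indicator (f ` P i) w)"
      by (rule ennreal_suminf_cmult)
    also have "\<dots> \<le> u w * (ennreal N * indicator B w)" by (intro mult_left_mono count) auto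
    finally show "(\<Sum>i. u w * indicator (f ` P i) w) \<le> ennreal N * (u w * indicator B w)"
      by (simp add: mult_ac)
  qed
  also have "\<dots> = ennreal N * (\<integral>\<^sup>+w\<in>B. u w \<partial>lborel)"
    by (intro nn_integral_cmult) measurable
  finally show ?thesis unfolding Y_def .
qed

section \<open>Logarithmic area\<close>

lemma entire_borel_measurable:
  assumes "entire f"
  shows "f \<in> borel_measurable borel" "deriv f \<in> borel_measurable borel"
  using assms unfolding entire_def
  by (auto intro!: borel_measurable_continuous_onI holomorphic_on_imp_continuous_on holomorphic_deriv)

lemma logarea_borel:
  assumes [measurable]: "A \<in> sets borel"
  shows "logarea A = (\<integral>\<^sup>+z\<in>A. ennreal (1 / (norm z)\<^sup>2) \<partial>lborel)"
  unfolding logarea_def by (intro nn_integral_completion) measurable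

lemma logarea_mono: "A \<subseteq> B \<Longrightarrow> logarea A \<le> logarea B"
  unfolding logarea_def by (intro nn_integral_mono) (auto split: split_indicator)

lemma logarea_UN_le:
  fixes A :: "nat \<Rightarrow> complex set"
  assumes [measurable]: "\<And>n. A n \<in> sets borel"
  shows "logarea (\<Union>n. A n) \<le> (\<Sum>n. logarea (A n))"
proof -
  have "(\<Sum>n. logarea (A n)) = (\<integral>\<^sup>+z. (\<Sum>n. ennreal (1 / (norm z)\<^sup>2) * indicator (A n) z) \<partial>lborel)"
      unfolding logarea_borel[OF assms] by (intro nn_integral_suminf[symmetric]) measurable
  moreover have "(\<Union>n. A n) \<in> sets borel" by measurable
  from logarea_borel[OF this]
  have "logarea (\<Union>n. A n) \<le> (\<integral>\<^sup>+z. (\<Sum>n. ennreal (1 / (norm z)\<^sup>2) * indicator (A n) z) \<partial>lborel)"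
  proof (simp only:, intro nn_integral_mono)
    fix z
    show "ennreal (1 / (norm z)\<^sup>2) * indicator (\<Union>n. A n) z
        \<le> (\<Sum>n. ennreal (1 / (norm z)\<^sup>2) * indicator (A n) z)"
    proof (cases "z \<in> (\<Union>n. A n)")
      case True
      then obtain n where "z \<in> A n" by auto
      then have "ennreal (1 / (norm z)\<^sup>2) * indicator (\<Union>n. A n) z = (\<Sum>i\<in>{n}. ennreal (1 / (norm z)\<^sup>2) * indicator (A i) z)"
        using True by simp
      also have "\<dots> \<le> (\<Sum>n. ennreal (1 / (norm z)\<^sup>2) * indicator (A n) z)"
        by (intro sum_le_suminf) auto
      finally show ?thesis .
    qed simp
  qed
  ultimately show ?thesis by simp
qed

lemma logarea_Un_le:
  assumes [measurable]: "A \<in> sets borel" "B \<in> sets borel"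
  shows "logarea (A \<union> B) \<le> logarea A + logarea B"
proof -
  have "logarea A + logarea B =
      (\<integral>\<^sup>+z. ennreal (1 / (norm z)\<^sup>2) * indicator A z + ennreal (1 / (norm z)\<^sup>2) * indicator B z \<partial>lborel)"
    unfolding logarea_borel[OF assms(1)] logarea_borel[OF assms(2)]
    by (intro nn_integral_add[symmetric]) measurable
  moreover have "logarea (A \<union> B) \<le> \<dots>"
    unfolding logarea_borel[OF sets.Un[OF assms]]
    by (intro nn_integral_mono) (auto split: split_indicator)
  ultimately show ?thesis by simp
qed

lemma logarea_outer_bounded:
  assumes "bounded A" "A \<subseteq> outer_region"
  shows "logarea A < \<infinity>"
proof -
  obtain R where R: "A \<subseteq> cball 0 R" using bounded_subset_ballD[OF assms(1), of 0] ball_subset_cball by blast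
  have "logarea A \<le> (\<integral>\<^sup>+z. indicator (cball (0::complex) R) z \<partial>lebesgue)"
    unfolding logarea_def
  proof (intro nn_integral_mono)
    fix z :: complex
    have "1 / (norm z)\<^sup>2 \<le> 1" if "1 \<le> norm z"
      using one_le_power[OF that, of 2] by (simp add: divide_le_eq)
    then show "ennreal (1 / (norm z)\<^sup>2) * indicator A z \<le> indicator (cball 0 R) z"
      using R assms(2) by (auto simp: outer_region_def split: split_indicator)
  qed
  also have "\<dots> < \<infinity>" using emeasure_bounded_finite[of "cball (0::complex) R"] by simp
  finally show ?thesis .
qed

text \<open>Each annulus \<open>2\<^sup>k < |z| \<le> 2\<^sup>k\<^sup>+\<^sup>1\<close> has area \<open>3 \<pi> 4\<^sup>k\<close>, on which \<open>1 / |z|\<^sup>2\<close> is at least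
  \<open>1 / 4\<^sup>k\<^sup>+\<^sup>1\<close>, and hence contributes at least \<open>3 \<pi> / 4\<close>.\<close>

lemma logarea_outer_region: "logarea outer_region = \<infinity>"
proof -
  define Q where "Q k = cball 0 (2 ^ Suc k) - cball (0::complex) (2 ^ k)" for k :: nat
  have [measurable]: "Q k \<in> sets borel" for k unfolding Q_def by auto
  have "disjoint_family Q"
  proof -
    have "Q j \<inter> Q k = {}" if "j < k" for j k
    proof -
      have "(2::real) ^ Suc j \<le> 2 ^ k" using that by (intro power_increasing) auto
      then show ?thesis by (auto simp: Q_def)
    qed
    then show ?thesis unfolding disjoint_family_on_def by (metis Int_commute linorder_neqE_nat)
  qed
  have lb: "ennreal (3 * pi / 4) \<le> (\<integral>\<^sup>+z\<in>Q k. ennreal (1 / (norm z)\<^sup>2) \<partial>lborel)" for k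
  proof -
    define r :: real where "r = 2 ^ k"
    have r: "r > 0" "2 ^ Suc k = 2 * r" by (simp_all add: r_def)
    have "emeasure lborel (Q k) = ennreal (pi * (2 * r)\<^sup>2) - ennreal (pi * r\<^sup>2)"
      unfolding Q_def r(2) r_def[symmetric] using r(1)
      by (subst emeasure_Diff) (auto simp: emeasure_cball unit_ball_vol_2)
    also have "\<dots> = ennreal (3 * pi * r\<^sup>2)"
      using r by (subst ennreal_minus) (auto simp: power2_eq_square algebra_simps)
    finally have e: "emeasure lborel (Q k) = ennreal (3 * pi * r\<^sup>2)" .
    have "ennreal (3 * pi / 4) = ennreal (1 / (2 * r)\<^sup>2) * emeasure lborel (Q k)"
      unfolding e using r by (subst ennreal_mult[symmetric]) (auto simp: power2_eq_square)
    also have "\<dots> = (\<integral>\<^sup>+z. ennreal (1 / (2 * r)\<^sup>2) * indicator (Q k) z \<partial>lborel)"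
      by (simp add: nn_integral_cmult_indicator)
    also have "\<dots> \<le> (\<integral>\<^sup>+z\<in>Q k. ennreal (1 / (norm z)\<^sup>2) \<partial>lborel)"
    proof (intro nn_integral_mono)
      fix z :: complex
      have "1 / (2 * r)\<^sup>2 \<le> 1 / (norm z)\<^sup>2" if "z \<in> Q k"
        using that r unfolding Q_def r(2) r_def[symmetric]
        by (intro divide_left_mono power_mono mult_pos_pos) auto
      then show "ennreal (1 / (2 * r)\<^sup>2) * indicator (Q k) z \<le> ennreal (1 / (norm z)\<^sup>2) * indicator (Q k) z"
        by (auto split: split_indicator intro!: ennreal_leI)
    qed
    finally show ?thesis .
  qed
  have "\<infinity> = (\<Sum>k::nat. ennreal (3 * pi / 4))"
    by (simp add: ennreal_mult_top flip: nn_integral_count_space_nat)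
  also have "\<dots> \<le> (\<Sum>k. \<integral>\<^sup>+z\<in>Q k. ennreal (1 / (norm z)\<^sup>2) \<partial>lborel)"
    by (intro suminf_le lb) auto
  also have "\<dots> = (\<integral>\<^sup>+z\<in>(\<Union>k. Q k). ennreal (1 / (norm z)\<^sup>2) \<partial>lborel)"
    using \<open>disjoint_family Q\<close> by (intro nn_integral_disjoint_family[symmetric]) auto
  also have "\<dots> = logarea (\<Union>k. Q k)"
    by (intro logarea_borel[symmetric]) auto
  also have "\<dots> \<le> logarea outer_region"
  proof (intro logarea_mono subsetI)
    fix z assume "z \<in> (\<Union>k. Q k)"
    then obtain k where "z \<in> Q k" by blast
    then have "2 ^ k < norm z" by (simp add: Q_def)
    moreover have "(1::real) \<le> 2 ^ k" by simp
    ultimately have "1 \<le> norm z" by linarith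
    then show "z \<in> outer_region" by (simp add: outer_region_def)
  qed
  finally show ?thesis by (simp add: top_unique)
qed

lemma outer_region_borel [measurable]: "outer_region \<in> sets borel"
  unfolding outer_region_def by measurable

lemma area_pos_if_cofinite_logarea:
  assumes [measurable]: "A \<in> sets borel" and fin: "logarea (outer_region - A) < \<infinity>"
  shows "area A > 0"
proof (rule ccontr)
  assume "\<not> area A > 0"
  then have "A \<in> null_sets lborel" by (auto simp: area_def null_sets_def)
  then have "(\<integral>\<^sup>+z\<in>A. ennreal (1 / (norm z)\<^sup>2) \<partial>lborel) = 0"
    by (intro nn_integral_null_set)
  then have "logarea A = 0" by (simp add: logarea_borel)
  moreover have "logarea outer_region \<le> logarea ((outer_region - A) \<union> A)"
    by (intro logarea_mono) auto
  moreover have "\<dots> \<le> logarea (outer_region - A) + logarea A"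
    by (intro logarea_Un_le) auto
  ultimately show False using fin by (simp add: logarea_outer_region top_unique)
qed

text \<open>The heart of the measure estimate. On the annulus \<open>r \<le> |z| < 2 r\<close> the density of logarithmic
  area is at most \<open>r powr (- (\<rho> + 2 \<epsilon>))\<close> times that of its pullback under \<open>f\<close>, and a point of
  \<open>B\<close> has at most \<open>C (2 r) powr (\<rho> + \<epsilon>)\<close> preimages there. The annulus thus contributes a
  constant times \<open>r powr (- \<epsilon>)\<close> times the logarithmic area of \<open>B\<close>. Over \<open>r = 2\<^sup>k R\<close> this is a
  geometric series, with a sum that tends to \<open>0\<close> as \<open>R\<close> grows.\<close>

lemma logarea_pullback_le_half:
  assumes "entire f" "growth_order f = ereal \<rho>" "0 \<le> \<rho>" "0 < \<epsilon>"
  obtains R0 where "1 \<le> R0"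
    "\<And>R B. \<lbrakk>R0 \<le> R; B \<in> sets borel; B \<subseteq> {w. R \<le> norm w}\<rbrakk> \<Longrightarrow>
       logarea {z. R \<le> norm z \<and> norm z powr (\<rho> / 2 + \<epsilon>) \<le> norm (z * deriv f z / f z) \<and> f z \<in> B}
         \<le> ennreal (1 / 2) * logarea B"
proof -
  define a where "a = \<rho> + \<epsilon>"
  define s where "s = \<rho> + 2 * \<epsilon>"
  have as: "0 < a" "0 < s" "s = a + \<epsilon>" using assms by (auto simp: a_def s_def)
  note [measurable] = entire_borel_measurable[OF assms(1)]
  have hol: "f holomorphic_on UNIV" using assms(1) by (simp add: entire_def)
  have lt: "growth_order f < ereal a" using assms by (simp add: a_def)
  obtain C R1 where C: "0 < C" "1 \<le> R1"
    "\<And>r w A. \<lbrakk>R1 \<le> r; R1 \<le> norm w; finite A; A \<subseteq> cball 0 r; f ` A \<subseteq> {w}\<rbrakk>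
       \<Longrightarrow> real (card A) \<le> C * r powr a"
    using preimage_count_bound[OF assms(1) lt as(1)] by blast
  \<comment> \<open>\<open>q\<close> is the ratio of the geometric series over the dyadic annuli, \<open>K * R powr (- \<epsilon>)\<close> its sum.\<close>
  define q where "q = (1 / 2) powr \<epsilon>"
  have q: "0 < q" "q < 1" using assms(4) by (auto simp: q_def powr01_less_one)
  define K where "K = C * 2 powr a / (1 - q)"
  have "((\<lambda>R. K * R powr (- \<epsilon>)) \<longlongrightarrow> K * 0) at_top"
    using assms(4) by (intro tendsto_mult tendsto_const tendsto_neg_powr filterlim_ident) auto
  then have "\<forall>\<^sub>F R in at_top. K * R powr (- \<epsilon>) < 1 / 2"
    by (rule order_tendstoD) auto
  then obtain R2 where R2: "\<And>R. R2 \<le> R \<Longrightarrow> K * R powr (- \<epsilon>) < 1 / 2"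
    unfolding eventually_at_top_linorder by auto
  define R0 where "R0 = max R1 R2"
  have "logarea {z. R \<le> norm z \<and> norm z powr (\<rho> / 2 + \<epsilon>) \<le> norm (z * deriv f z / f z) \<and> f z \<in> B}
         \<le> ennreal (1 / 2) * logarea B"
    if R: "R0 \<le> R" and B: "B \<in> sets borel" "B \<subseteq> {w. R \<le> norm w}" for R B
  proof -
    have R1: "R1 \<le> R" "1 \<le> R" "R2 \<le> R" using R C(2) by (auto simp: R0_def)
    note [measurable] = B(1)
    define u where "u w = ennreal (1 / (norm w)\<^sup>2)" for w :: complex
    have [measurable]: "u \<in> borel_measurable borel" unfolding u_def[abs_def] by measurable
    define G where "G = {z. norm z powr (\<rho> / 2 + \<epsilon>) \<le> norm (z * deriv f z / f z)}"
    have [measurable]: "G \<in> sets borel" unfolding G_def by measurable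
    define r where "r k = 2 ^ k * R" for k :: nat
    have r: "R \<le> r k" "r (Suc k) = 2 * r k" for k
      using R1 mult_right_mono[of 1 "2 ^ k" R] by (auto simp: r_def)
    define X where "X k = {z. r k \<le> norm z \<and> norm z < r (Suc k)} \<inter> G" for k
    have Xb [measurable]: "X k \<in> sets borel" for k unfolding X_def by measurable
    have dens: "ennreal (1 / (norm z)\<^sup>2) \<le> ennreal (r k powr (- s)) * (ennreal ((norm (deriv f z))\<^sup>2) * u (f z))"
      and dnz: "deriv f z \<noteq> 0" if z: "z \<in> X k" for z k
    proof -
      have zr: "r k \<le> norm z" "1 \<le> norm z" "z \<noteq> 0" using z r[of k] R1 by (auto simp: X_def)
      have G: "norm z powr (\<rho> / 2 + \<epsilon>) \<le> norm (z * deriv f z / f z)"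
        using z by (simp add: X_def G_def)
      moreover have "0 < norm z powr (\<rho> / 2 + \<epsilon>)" using zr by simp
      ultimately have "norm (z * deriv f z / f z) > 0" by linarith
      then show nz: "deriv f z \<noteq> 0" by auto
      have "norm z powr s = (norm z powr (\<rho> / 2 + \<epsilon>))\<^sup>2"
        using zr by (simp add: power2_eq_square s_def flip: powr_add)
      also have "\<dots> \<le> (norm (z * deriv f z / f z))\<^sup>2"
        using G by (intro power_mono) auto
      also have "\<dots> = (norm z)\<^sup>2 * ((norm (deriv f z))\<^sup>2 * (1 / (norm (f z))\<^sup>2))"
        by (simp add: norm_mult norm_divide power_mult_distrib power_divide)
      finally have "norm z powr s / (norm z)\<^sup>2 \<le> (norm (deriv f z))\<^sup>2 * (1 / (norm (f z))\<^sup>2)"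
        using zr by (simp add: field_simps)
      then have "norm z powr (- s) * (norm z powr s / (norm z)\<^sup>2)
          \<le> norm z powr (- s) * ((norm (deriv f z))\<^sup>2 * (1 / (norm (f z))\<^sup>2))"
        by (intro mult_left_mono) auto
      also have "norm z powr (- s) * (norm z powr s / (norm z)\<^sup>2) = 1 / (norm z)\<^sup>2"
        using zr by (simp add: powr_minus field_simps)
      also have "norm z powr (- s) * ((norm (deriv f z))\<^sup>2 * (1 / (norm (f z))\<^sup>2))
          \<le> r k powr (- s) * ((norm (deriv f z))\<^sup>2 * (1 / (norm (f z))\<^sup>2))"
        using zr r[of k] R1 as by (intro mult_right_mono powr_mono2') auto
      finally show "ennreal (1 / (norm z)\<^sup>2) \<le> ennreal (r k powr (- s)) * (ennreal ((norm (deriv f z))\<^sup>2) * u (f z))"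
        unfolding u_def by (simp add: ennreal_leI flip: ennreal_mult)
    qed
    have piece: "(\<integral>\<^sup>+z\<in>X k \<inter> f -` B. ennreal (1 / (norm z)\<^sup>2) \<partial>lborel)
        \<le> ennreal (C * 2 powr a * R powr (- \<epsilon>) * q ^ k) * logarea B" for k
    proof -
      have "(\<integral>\<^sup>+z\<in>X k \<inter> f -` B. ennreal (1 / (norm z)\<^sup>2) \<partial>lborel)
          \<le> (\<integral>\<^sup>+z. ennreal (r k powr (- s)) * (ennreal ((norm (deriv f z))\<^sup>2) * u (f z) * indicator (X k \<inter> f -` B) z) \<partial>lborel)"
        by (intro nn_integral_mono) (auto intro!: dens split: split_indicator)
      also have "\<dots> = ennreal (r k powr (- s)) * (\<integral>\<^sup>+z\<in>X k \<inter> f -` B. ennreal ((norm (deriv f z))\<^sup>2) * u (f z) \<partial>lborel)"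
      proof (rule nn_integral_cmult)
        have "f -` B \<inter> space borel \<in> sets borel" by measurable
        then have [measurable]: "f -` B \<in> sets borel" by simp
        show "(\<lambda>z. ennreal ((norm (deriv f z))\<^sup>2) * u (f z) * indicator (X k \<inter> f -` B) z) \<in> borel_measurable lborel"
          by measurable
      qed
      also have "\<dots> \<le> ennreal (r k powr (- s)) * (ennreal (C * r (Suc k) powr a) * (\<integral>\<^sup>+w\<in>B. u w \<partial>lborel))"
      proof (intro mult_left_mono nn_integral_substitution_multiplicity_le[OF hol Xb _ _ B(1)])
        show "bounded (X k)"
          by (rule bounded_subset[OF bounded_cball[of 0 "r (Suc k)"]]) (auto simp: X_def)
        fix w A assume w: "w \<in> B" and A: "finite A" "A \<subseteq> X k" "f ` A \<subseteq> {w}"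
        show "real (card A) \<le> C * r (Suc k) powr a"
          using A w B(2) R1 r(1)[of "Suc k"] by (intro C(3)[of _ w]) (auto simp: X_def)
      qed (use dnz in auto)
      also have "(\<integral>\<^sup>+w\<in>B. u w \<partial>lborel) = logarea B" by (simp add: logarea_borel u_def)
      also have "ennreal (r k powr (- s)) * (ennreal (C * r (Suc k) powr a) * logarea B) =
          ennreal (r k powr (- s) * (C * r (Suc k) powr a)) * logarea B"
        using C(1) by (simp add: ennreal_mult mult.assoc)
      also have "r k powr (- s) * (C * r (Suc k) powr a) = C * 2 powr a * (r k powr (- s) * r k powr a)"
        using R1 r[of k] by (simp add: powr_mult)
      also have "r k powr (- s) * r k powr a = r k powr (- \<epsilon>)"
        by (simp add: as(3) flip: powr_add)
      also have "\<dots> = R powr (- \<epsilon>) * q ^ k"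
        using R1 by (simp add: r_def q_def powr_mult powr_minus powr_divide powr_power powr_powr
            power_one_over inverse_eq_divide mult.commute flip: powr_realpow)
      finally show ?thesis by (simp add: mult.assoc)
    qed
    have "{z. R \<le> norm z \<and> norm z powr (\<rho> / 2 + \<epsilon>) \<le> norm (z * deriv f z / f z) \<and> f z \<in> B}
        \<subseteq> (\<Union>k. X k \<inter> f -` B)"
    proof
      fix z assume "z \<in> {z. R \<le> norm z \<and> norm z powr (\<rho> / 2 + \<epsilon>) \<le> norm (z * deriv f z / f z) \<and> f z \<in> B}"
      then have z: "R \<le> norm z" "z \<in> G" "z \<in> f -` B" by (auto simp: G_def)
      obtain n where n: "norm z / R < 2 ^ n" using real_arch_pow[of 2 "norm z / R"] by auto
      define m where "m = (LEAST n. norm z < r n)"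
      have "norm z < r n" using n R1 by (simp add: r_def field_simps)
      then have m: "norm z < r m" "\<And>k. k < m \<Longrightarrow> r k \<le> norm z"
        unfolding m_def by (rule LeastI, meson not_less_Least not_le)
      have "m \<noteq> 0" using m(1) z(1) by (auto simp: r_def intro: Nat.gr0I)
      then obtain k where "m = Suc k" by (cases m) auto
      then have "z \<in> X k" using m z by (auto simp: X_def)
      then show "z \<in> (\<Union>k. X k \<inter> f -` B)" using z by auto
    qed
    then have "logarea {z. R \<le> norm z \<and> norm z powr (\<rho> / 2 + \<epsilon>) \<le> norm (z * deriv f z / f z) \<and> f z \<in> B}
        \<le> logarea (\<Union>k. X k \<inter> f -` B)" by (rule logarea_mono)
    also have XB: "X k \<inter> f -` B \<in> sets borel" for k
    proof -
      have "f -` B \<inter> space borel \<in> sets borel" by measurable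
      then show ?thesis by simp
    qed
    then have "logarea (\<Union>k. X k \<inter> f -` B) \<le> (\<Sum>k. logarea (X k \<inter> f -` B))"
      by (rule logarea_UN_le)
    also have "\<dots> \<le> (\<Sum>k. ennreal (C * 2 powr a * R powr (- \<epsilon>) * q ^ k) * logarea B)"
      by (intro suminf_le) (auto simp: logarea_borel[OF XB] piece)
    also have "\<dots> = (\<Sum>k. ennreal (C * 2 powr a * R powr (- \<epsilon>) * q ^ k)) * logarea B"
      by simp
    also have "(\<Sum>k. ennreal (C * 2 powr a * R powr (- \<epsilon>) * q ^ k)) = ennreal (\<Sum>k. C * 2 powr a * R powr (- \<epsilon>) * q ^ k)"
      using C(1) q by (intro suminf_ennreal2) (auto intro!: summable_mult summable_geometric)
    also have "(\<Sum>k. C * 2 powr a * R powr (- \<epsilon>) * q ^ k) = K * R powr (- \<epsilon>)"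
      using q by (simp add: suminf_mult summable_geometric suminf_geometric K_def)
    also have "ennreal (K * R powr (- \<epsilon>)) * logarea B \<le> ennreal (1 / 2) * logarea B"
      using R2[OF R1(3)] by (intro mult_right_mono ennreal_leI) auto
    finally show ?thesis .
  qed
  then show ?thesis using that[of R0] C(2) by (auto simp: R0_def)
qed

section \<open>Fatou and Julia sets\<close>

lemma entire_funpow:
  assumes "entire f"
  shows "f ^^ n holomorphic_on UNIV"
proof (induction n)
  case (Suc n)
  then have "f \<circ> (f ^^ n) holomorphic_on UNIV"
    using assms unfolding entire_def
    by (intro holomorphic_on_compose) (auto intro: holomorphic_on_subset)
  then show ?case by (simp only: funpow.simps)
qed (simp add: id_def)

lemma open_Fatou: "open (Fatou f)"
proof (subst open_subopen, intro ballI)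
  fix z assume "z \<in> Fatou f"
  then obtain U where U: "open U" "connected U" "z \<in> U" "normal_family_on U (range (\<lambda>n. f ^^ n))"
    by (auto simp: Fatou_def)
  then have "U \<subseteq> Fatou f" by (auto simp: Fatou_def)
  then show "\<exists>T. open T \<and> z \<in> T \<and> T \<subseteq> Fatou f" using U by blast
qed

lemma normal_iterates_subsequence:
  fixes m :: "nat \<Rightarrow> nat"
  assumes "normal_family_on U (range (\<lambda>n. f ^^ n))"
  shows "\<exists>k. strict_mono k \<and>
    ((\<exists>g. \<forall>L. compact L \<and> L \<subseteq> U \<longrightarrow> uniform_limit L (\<lambda>n. f ^^ m (k n)) g sequentially) \<or>
     (\<forall>L. compact L \<and> L \<subseteq> U \<longrightarrow>
        (\<forall>B::real. \<forall>\<^sub>F n in sequentially. \<forall>z\<in>L. norm ((f ^^ m (k n)) z) > B)))"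
proof -
  have "range (\<lambda>n. f ^^ m n) \<subseteq> range (\<lambda>n. f ^^ n)" by auto
  with assms show ?thesis unfolding normal_family_on_def by (elim allE[of _ "\<lambda>n. f ^^ m n"] impE)
qed

text \<open>If the iterates are normal on \<open>U\<close>, they are normal on \<open>f ` U\<close>: since \<open>f\<close> is open, every compact
  subset of \<open>f ` U\<close> is covered by the image of a compact subset of \<open>U\<close>, and the iterates on the
  latter, shifted by one, control those on the former.\<close>

lemma Fatou_forward_invariant:
  assumes f: "entire f" "\<not> f constant_on UNIV" and z: "z \<in> Fatou f"
  shows "f z \<in> Fatou f"
proof -
  obtain U where U: "open U" "connected U" "z \<in> U" "normal_family_on U (range (\<lambda>n. f ^^ n))"
    using z by (auto simp: Fatou_def)
  have hol: "f holomorphic_on UNIV" using f by (simp add: entire_def)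
  then have cont: "continuous_on S f" for S
    by (meson continuous_on_subset holomorphic_on_imp_continuous_on subset_UNIV)
  have opn: "open (f ` V)" if "open V" for V
    by (rule open_mapping_thm[OF hol open_UNIV connected_UNIV that subset_UNIV f(2)])
  have lift: "\<exists>L. compact L \<and> L \<subseteq> U \<and> K \<subseteq> f ` L" if K: "compact K" "K \<subseteq> f ` U" for K
  proof -
    have "\<exists>x r. w = f x \<and> 0 < r \<and> cball x r \<subseteq> U" if w: "w \<in> K" for w
    proof -
      obtain x where x: "x \<in> U" "w = f x" using K(2) w by blast
      then obtain r where "0 < r" "cball x r \<subseteq> U" using U(1) open_contains_cball by blast
      then show ?thesis using x(2) by blast
    qed
    then have "\<forall>w\<in>K. \<exists>x r. w = f x \<and> 0 < r \<and> cball x r \<subseteq> U" by blast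
    from bchoice[OF this] obtain x where "\<forall>w\<in>K. \<exists>r. w = f (x w) \<and> 0 < r \<and> cball (x w) r \<subseteq> U" ..
    from bchoice[OF this] obtain r where xr: "\<forall>w\<in>K. w = f (x w) \<and> 0 < r w \<and> cball (x w) (r w) \<subseteq> U" ..
    have "K \<subseteq> (\<Union>w\<in>K. f ` ball (x w) (r w))"
    proof
      fix w assume "w \<in> K"
      then have "w \<in> f ` ball (x w) (r w)" using xr by (intro image_eqI[of _ f "x w"]) auto
      with \<open>w \<in> K\<close> show "w \<in> (\<Union>w\<in>K. f ` ball (x w) (r w))" by (rule UN_I)
    qed
    from compactE_image[OF K(1) opn[OF open_ball] this]
    obtain T where T: "T \<subseteq> K" "finite T" "K \<subseteq> (\<Union>w\<in>T. f ` ball (x w) (r w))" .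
    define L where "L = (\<Union>w\<in>T. cball (x w) (r w))"
    have "compact L" unfolding L_def using T(2) by (intro compact_UN) auto
    moreover have "L \<subseteq> U" unfolding L_def using xr T(1) by blast
    moreover have "(\<Union>w\<in>T. f ` ball (x w) (r w)) \<subseteq> f ` L"
      unfolding L_def image_UN by (intro UN_mono image_mono ball_subset_cball order_refl)
    with T(3) have "K \<subseteq> f ` L" by (rule order_trans)
    ultimately show ?thesis by blast
  qed
  have "normal_family_on (f ` U) (range (\<lambda>n. f ^^ n))"
    unfolding normal_family_on_def
  proof (intro allI impI)
    fix h :: "nat \<Rightarrow> complex \<Rightarrow> complex"
    assume "range h \<subseteq> range (\<lambda>n. f ^^ n)"
    then have "\<forall>n. \<exists>m. h n = f ^^ m" by (auto simp: image_subset_iff)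
    then obtain m where m: "\<And>n. h n = f ^^ m n" by metis
    have hf: "h n (f x) = (f ^^ Suc (m n)) x" for n x
      by (simp add: m funpow_swap1)
    obtain k where k: "strict_mono k" and
      alt: "(\<exists>g. \<forall>L. compact L \<and> L \<subseteq> U \<longrightarrow> uniform_limit L (\<lambda>n. f ^^ Suc (m (k n))) g sequentially) \<or>
        (\<forall>L. compact L \<and> L \<subseteq> U \<longrightarrow>
             (\<forall>B::real. \<forall>\<^sub>F n in sequentially. \<forall>z\<in>L. norm ((f ^^ Suc (m (k n))) z) > B))"
      using normal_iterates_subsequence[OF U(4), of "\<lambda>n. Suc (m n)"] by (elim exE conjE)
    have "(\<exists>g. \<forall>K. compact K \<and> K \<subseteq> f ` U \<longrightarrow> uniform_limit K (\<lambda>n. h (k n)) g sequentially) \<or>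
          (\<forall>K. compact K \<and> K \<subseteq> f ` U \<longrightarrow>
             (\<forall>B::real. \<forall>\<^sub>F n in sequentially. \<forall>z\<in>K. norm (h (k n) z) > B))"
      using alt
    proof (elim disjE exE)
      fix g assume g: "\<forall>L. compact L \<and> L \<subseteq> U \<longrightarrow> uniform_limit L (\<lambda>n. f ^^ Suc (m (k n))) g sequentially"
      \<comment> \<open>The limit \<open>g\<close> on \<open>U\<close> is constant on the fibres of \<open>f\<close> and so descends to \<open>f ` U\<close>.\<close>
      define G where "G w = lim (\<lambda>n. h (k n) w)" for w
      have Gf: "G (f x) = g x" if "x \<in> U" for x
      proof -
        have "uniform_limit {x} (\<lambda>n. f ^^ Suc (m (k n))) g sequentially"
          using g[rule_format, of "{x}"] that by simp
        then have "(\<lambda>n. (f ^^ Suc (m (k n))) x) \<longlonglongrightarrow> g x"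
          by (rule tendsto_uniform_limitI) simp
        then show ?thesis unfolding G_def hf by (rule limI)
      qed
      have "uniform_limit K (\<lambda>n. h (k n)) G sequentially" if K: "compact K" "K \<subseteq> f ` U" for K
      proof (rule uniform_limitI)
        fix e :: real assume e: "e > 0"
        obtain L where L: "compact L" "L \<subseteq> U" "K \<subseteq> f ` L" using lift[OF K] by (elim exE conjE)
        have "uniform_limit L (\<lambda>n. f ^^ Suc (m (k n))) g sequentially"
          by (rule g[rule_format, OF conjI[OF L(1,2)]])
        from uniform_limitD[OF this e]
        show "\<forall>\<^sub>F n in sequentially. \<forall>w\<in>K. dist (h (k n) w) (G w) < e"
        proof eventually_elim
          case (elim n)
          show ?case
          proof
            fix w assume "w \<in> K"
            then obtain x where "x \<in> L" "w = f x" using L by blast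
            then show "dist (h (k n) w) (G w) < e" using elim L Gf[of x] hf[of "k n" x] by auto
          qed
        qed
      qed
      then show ?thesis by (intro disjI1 exI[of _ G] allI impI) (elim conjE)
    next
      assume a: "\<forall>L. compact L \<and> L \<subseteq> U \<longrightarrow>
             (\<forall>B::real. \<forall>\<^sub>F n in sequentially. \<forall>z\<in>L. norm ((f ^^ Suc (m (k n))) z) > B)"
      have "\<forall>\<^sub>F n in sequentially. \<forall>w\<in>K. norm (h (k n) w) > B" if K: "compact K" "K \<subseteq> f ` U" for K and B :: real
      proof -
        obtain L where L: "compact L" "L \<subseteq> U" "K \<subseteq> f ` L" using lift[OF K] by (elim exE conjE)
        have "\<forall>\<^sub>F n in sequentially. \<forall>z\<in>L. norm ((f ^^ Suc (m (k n))) z) > B"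
          by (rule a[rule_format, OF conjI[OF L(1,2)]])
        then show ?thesis
        proof eventually_elim
          case (elim n)
          show ?case
          proof
            fix w assume "w \<in> K"
            then obtain x where "x \<in> L" "w = f x" using L by blast
            then show "norm (h (k n) w) > B" using elim hf[of "k n" x] by auto
          qed
        qed
      qed
      then show ?thesis by (intro disjI2 allI impI) (elim conjE)
    qed
    with k show "\<exists>k::nat \<Rightarrow> nat. strict_mono k \<and>
         ((\<exists>g. \<forall>K. compact K \<and> K \<subseteq> f ` U \<longrightarrow> uniform_limit K (\<lambda>n. h (k n)) g sequentially) \<or>
          (\<forall>K. compact K \<and> K \<subseteq> f ` U \<longrightarrow>
             (\<forall>B::real. \<forall>\<^sub>F n in sequentially. \<forall>z\<in>K. norm (h (k n) z) > B)))"
      by (intro exI[of _ k] conjI)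
  qed
  moreover have "connected (f ` U)" using connected_continuous_image[OF cont U(2)] .
  ultimately show ?thesis
    using opn[OF U(1)] imageI[OF U(3), of f] unfolding Fatou_def mem_Collect_eq
    by (intro exI[of _ "f ` U"] conjI)
qed

lemma Fatou_funpow:
  assumes "entire f" "\<not> f constant_on UNIV" "z \<in> Fatou f"
  shows "(f ^^ n) z \<in> Fatou f"
  by (induction n) (use assms Fatou_forward_invariant in auto)

text \<open>On a set where the iterates are normal, either every orbit escapes or none does: if \<open>z\<close> escapes and
  \<open>z'\<close> has bounded iterates along a subsequence, then no subsequence of that one converges to a finite
  limit at \<open>z\<close> or tends to infinity at \<open>z'\<close>.\<close>

lemma escaping_spreads:
  assumes nor: "normal_family_on U (range (\<lambda>n. f ^^ n))"
    and z: "z \<in> U" "z \<in> escaping f" "z' \<in> U"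
  shows "z' \<in> escaping f"
proof (rule ccontr)
  assume "z' \<notin> escaping f"
  then have "\<not> (\<forall>r>0. \<forall>\<^sub>F n in sequentially. r \<le> norm ((f ^^ n) z'))"
    unfolding escaping_def by (simp add: filterlim_at_infinity[of 0])
  then obtain B where "\<exists>\<^sub>F n in sequentially. \<not> B \<le> norm ((f ^^ n) z')"
    by (auto simp: not_eventually)
  then have inf: "infinite {n. norm ((f ^^ n) z') < B}"
    by (simp add: frequently_sequentially INFM_iff_infinite not_le flip: cofinite_eq_sequentially)
  define m where "m = enumerate {n. norm ((f ^^ n) z') < B}"
  have m: "strict_mono m" "norm ((f ^^ m n) z') < B" for n
    using strict_mono_enumerate[OF inf] enumerate_in_set[OF inf] by (auto simp: m_def)
  obtain k where k: "strict_mono k" and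
    alt: "(\<exists>g. \<forall>L. compact L \<and> L \<subseteq> U \<longrightarrow> uniform_limit L (\<lambda>n. f ^^ m (k n)) g sequentially) \<or>
      (\<forall>L. compact L \<and> L \<subseteq> U \<longrightarrow>
           (\<forall>B::real. \<forall>\<^sub>F n in sequentially. \<forall>z\<in>L. norm ((f ^^ m (k n)) z) > B))"
    using normal_iterates_subsequence[OF nor, of m] by (elim exE conjE)
  from alt show False
  proof (elim disjE exE)
    fix g assume g: "\<forall>L. compact L \<and> L \<subseteq> U \<longrightarrow> uniform_limit L (\<lambda>n. f ^^ m (k n)) g sequentially"
    have "uniform_limit {z} (\<lambda>n. f ^^ m (k n)) g sequentially"
      using g[rule_format, of "{z}"] z(1) by simp
    then have lim: "(\<lambda>n. (f ^^ m (k n)) z) \<longlonglongrightarrow> g z"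
      by (rule tendsto_uniform_limitI) simp
    have "filterlim (\<lambda>n. m (k n)) sequentially sequentially"
      using filterlim_subseq[OF strict_mono_o[OF m(1) k]] by (simp add: o_def)
    then have "filterlim (\<lambda>n. (f ^^ m (k n)) z) at_infinity sequentially"
      using z(2) unfolding escaping_def by (auto intro: filterlim_compose[of "\<lambda>n. (f ^^ n) z"])
    then show False using lim not_tendsto_and_filterlim_at_infinity[of sequentially] by auto
  next
    assume a: "\<forall>L. compact L \<and> L \<subseteq> U \<longrightarrow>
           (\<forall>B::real. \<forall>\<^sub>F n in sequentially. \<forall>z\<in>L. norm ((f ^^ m (k n)) z) > B)"
    have "\<forall>\<^sub>F n in sequentially. norm ((f ^^ m (k n)) z') > B"
      using a[rule_format, of "{z'}" B] z(3) by simp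
    then obtain n where "norm ((f ^^ m (k n)) z') > B"
      by (auto dest: eventually_happens'[OF sequentially_bot])
    then show False using m(2)[of "k n"] by simp
  qed
qed

text \<open>If \<open>f \<circ> f\<close> has no fixed point, then neither has \<open>f\<close>, and \<open>(f (f z) - z) / (f z - z)\<close> omits
  \<open>0\<close> and \<open>1\<close>; by Picard's theorem it is a constant \<open>c\<close>. Differentiating
  \<open>f (f z) - z = c (f z - z)\<close> shows that \<open>f' \<circ> f\<close> omits \<open>0\<close> and \<open>c\<close>, so it is constant as well,
  which makes \<open>f'\<close> constant and \<open>f\<close> linear.\<close>

lemma exists_period_two_point:
  assumes f: "entire f" "\<not> linear_fun f"
  shows "\<exists>q. f (f q) = q"
proof (rule ccontr)
  assume no: "\<nexists>q. f (f q) = q"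
  then have no1: "f z \<noteq> z" for z by metis
  have hol: "f holomorphic_on UNIV" using f by (simp add: entire_def)
  have holff: "(\<lambda>z. f (f z)) holomorphic_on UNIV"
    using holomorphic_on_compose[OF hol, of f] hol by (auto simp: o_def intro: holomorphic_on_subset)
  define g where "g z = (f (f z) - z) / (f z - z)" for z
  have "g holomorphic_on UNIV"
    unfolding g_def[abs_def] using no1 by (intro holomorphic_intros hol holff) auto
  moreover have "range g \<inter> {0, 1} = {}"
    using no no1 by (auto simp: g_def)
  ultimately obtain c where c: "g = (\<lambda>z. c)"
    using little_Picard[of g 0 1] by auto
  have c01: "c \<noteq> 0" "c \<noteq> 1" using c \<open>range g \<inter> {0, 1} = {}\<close> by auto
  have eq: "f (f z) = z + c * (f z - z)" for z
    using fun_cong[OF c, of z] no1[of z] by (simp add: g_def divide_eq_eq algebra_simps)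
  have df: "(f has_field_derivative deriv f z) (at z)" for z
    using hol by (simp add: holomorphic_derivI)
  have deq: "deriv f z * (deriv f (f z) - c) = 1 - c" for z
  proof -
    have "((\<lambda>z. f (f z)) has_field_derivative deriv f (f z) * deriv f z) (at z)"
      by (rule DERIV_chain2[OF df df])
    moreover have "((\<lambda>z. z + c * (f z - z)) has_field_derivative 1 + c * (deriv f z - 1)) (at z)"
      by (auto intro!: derivative_eq_intros df)
    ultimately have "deriv f (f z) * deriv f z = 1 + c * (deriv f z - 1)"
      unfolding eq by (rule DERIV_unique)
    then show ?thesis by (simp add: algebra_simps)
  qed
  define d where "d z = deriv f (f z)" for z
  have "d z \<noteq> 0" for z using deq[of "f z"] c01 by (auto simp: d_def)
  moreover have "d z \<noteq> c" for z using deq[of z] c01 by (auto simp: d_def)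
  ultimately have "range d \<inter> {0, c} = {}" by auto
  moreover have "d holomorphic_on UNIV"
    using holomorphic_on_compose[OF hol, of "deriv f"] holomorphic_deriv[OF hol]
    by (auto simp: o_def d_def[abs_def] intro: holomorphic_on_subset)
  ultimately obtain e where e: "d = (\<lambda>z. e)"
    using little_Picard[of d 0 c] c01 by auto
  have "deriv f z * (e - c) = 1 - c" for z
    using deq[of z] fun_cong[OF e, of z] by (simp add: d_def)
  moreover have "e \<noteq> c" using calculation[of 0] c01 by auto
  ultimately have const: "deriv f z = (1 - c) / (e - c)" for z
    by (simp add: field_simps)
  define b where "b = (1 - c) / (e - c)"
  have "((\<lambda>z. f z - b * z) has_field_derivative 0) (at z)" for z
  proof -
    have "deriv f z - b * 1 = 0" by (simp add: const b_def)
    then show ?thesis using DERIV_diff[OF df[of z] DERIV_cmult[OF DERIV_ident, of b]] by simp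
  qed
  then obtain a where "\<And>z. f z - b * z = a"
    using has_field_derivative_zero_constant[of UNIV "\<lambda>z. f z - b * z"] by auto
  then have "f z = b * z + a" for z by (metis add.commute diff_add_cancel)
  then show False using f(2) unfolding linear_fun_def by blast
qed

text \<open>If every point were in the Fatou set, the escaping set would be open and closed, hence everything;
  but a periodic point does not escape.\<close>

lemma Julia_nonempty:
  assumes f: "entire f" "\<not> linear_fun f" and esc: "escaping f \<noteq> {}"
  shows "Julia f \<noteq> {}"
proof
  assume "Julia f = {}"
  then have nbhd: "\<exists>U. open U \<and> z \<in> U \<and> normal_family_on U (range (\<lambda>n. f ^^ n))" for z
    by (auto simp: Julia_def Fatou_def)
  have "open (escaping f)" "open (- escaping f)"
  proof -
    show "open (escaping f)"
      by (subst open_subopen) (meson nbhd escaping_spreads subsetI)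
    show "open (- escaping f)"
      by (subst open_subopen) (metis ComplD ComplI nbhd escaping_spreads subsetI)
  qed
  then have "escaping f = UNIV"
    using clopen[of "escaping f"] esc by (simp add: closed_def)
  obtain q where q: "f (f q) = q" using exists_period_two_point[OF f] by blast
  have orb: "(f ^^ n) q \<in> {q, f q}" for n by (induction n) (use q in auto)
  have "q \<in> escaping f" using \<open>escaping f = UNIV\<close> by simp
  then have "\<forall>\<^sub>F n in sequentially. norm q + norm (f q) + 1 \<le> norm ((f ^^ n) q)"
    unfolding escaping_def by (simp add: filterlim_at_infinity[of 0] add_nonneg_pos)
  then obtain n where "norm q + norm (f q) + 1 \<le> norm ((f ^^ n) q)"
    by (auto dest: eventually_happens)
  then show False
    using orb[of n] norm_ge_zero[of q] norm_ge_zero[of "f q"] by (auto simp del: norm_ge_zero)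
qed

lemma circle_in_Fatou_imp_multiply_connected:
  assumes "p \<notin> Fatou f" "0 < r" "sphere p r \<subseteq> Fatou f"
  shows "\<exists>C\<in>components (Fatou f). \<not> simply_connected C"
proof -
  have "connected (sphere p r)" "sphere p r \<noteq> {}"
    using assms(2) by (auto intro: connected_sphere)
  then obtain C where C: "C \<in> components (Fatou f)" "sphere p r \<subseteq> C"
    using exists_component_superset[OF assms(3)] assms(3) by (metis subset_empty)
  have "p \<notin> C" using C assms(1) in_components_subset by blast
  have "\<not> simply_connected C"
  proof
    assume "simply_connected C"
    then have "winding_number (circlepath p r) p = 0"
      using C(2) assms(2) \<open>p \<notin> C\<close> by (intro simply_connected_imp_winding_number_zero[of C]) auto
    then show False using assms(2) by (simp add: winding_number_circlepath_centre)
  qed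
  then show ?thesis using C(1) by blast
qed

text \<open>A logarithm \<open>h\<close> of \<open>g - p\<close> has derivative \<open>g' / (g - p)\<close>. By Bloch's theorem \<open>h\<close> covers a disc of
  radius \<open>\<delta> |h'(z)| / 12 \<ge> 4\<close>. As \<open>4 > \<pi>\<close>, the disc contains a vertical segment of length
  \<open>2 \<pi>\<close> centred at its midpoint, whose exponential is a full circle; the constant \<open>48\<close> is
  \<open>4 * 12\<close>.\<close>

lemma image_contains_circle_around_omitted_value:
  assumes g: "g holomorphic_on ball z \<delta>" and \<delta>: "0 < \<delta>" and p: "p \<notin> g ` ball z \<delta>"
    and big: "48 * norm (g z - p) \<le> \<delta> * norm (deriv g z)"
  shows "\<exists>r>0. sphere p r \<subseteq> g ` ball z \<delta>"
proof -
  obtain h where h: "h holomorphic_on ball z \<delta>" "\<And>x. x \<in> ball z \<delta> \<Longrightarrow> exp (h x) = g x - p"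
  proof (rule holomorphic_logarithm_exists[of "ball z \<delta>" "\<lambda>x. g x - p" z])
    show "(\<lambda>x. g x - p) holomorphic_on ball z \<delta>" by (intro holomorphic_intros g)
    show "g x - p \<noteq> 0" if "x \<in> ball z \<delta>" for x using p that by auto
  qed (use \<delta> in auto)
  have zin: "z \<in> ball z \<delta>" using \<delta> by simp
  have dh: "(h has_field_derivative deriv h z) (at z)"
    using h(1) zin by (auto intro: holomorphic_derivI)
  have "((\<lambda>x. exp (h x) + p) has_field_derivative exp (h z) * deriv h z) (at z)"
    by (auto intro!: derivative_eq_intros dh)
  then have "(g has_field_derivative exp (h z) * deriv h z) (at z)"
    by (rule has_field_derivative_transform_within_open[of _ _ _ "ball z \<delta>"]) (use h zin in auto)
  then have "deriv g z = (g z - p) * deriv h z" using h(2)[OF zin] by (simp add: DERIV_imp_deriv)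
  then have "norm (g z - p) * 48 \<le> norm (g z - p) * (\<delta> * norm (deriv h z))"
    using big by (simp add: norm_mult mult_ac)
  moreover have "norm (g z - p) > 0" using p zin by auto
  ultimately have "48 \<le> \<delta> * norm (deriv h z)" by simp
  then obtain b where b: "ball b 4 \<subseteq> h ` ball z \<delta>"
    using Bloch[OF h(1) \<delta>, of 4] by auto
  have "sphere p (exp (Re b)) \<subseteq> g ` ball z \<delta>"
  proof
    fix w assume "w \<in> sphere p (exp (Re b))"
    then have w: "norm (w - p) = exp (Re b)" by (simp add: dist_norm norm_minus_commute)
    define t where "t = Arg ((w - p) / exp b)"
    have nrm: "norm ((w - p) / exp b) = 1" by (simp add: norm_divide w)
    then have "(w - p) / exp b = exp (\<i> * t)"
      unfolding t_def by (subst cis_conv_exp[symmetric]) (metis cis_Arg norm_zero zero_neq_one sgn_eq div_by_1 of_real_1)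
    then have "w - p = exp (b + \<i> * t)" by (simp add: exp_add field_simps)
    moreover have "b + \<i> * t \<in> ball b 4"
      using Arg_bounded[of "(w - p) / exp b"] pi_less_4 by (auto simp: dist_norm norm_mult t_def)
    then obtain x where "x \<in> ball z \<delta>" "h x = b + \<i> * t" using b by (metis imageE subsetD)
    ultimately have "w = g x" using h(2)[of x] by (metis diff_add_cancel)
    then show "w \<in> g ` ball z \<delta>" using \<open>x \<in> ball z \<delta>\<close> by blast
  qed
  then show ?thesis by (intro exI[of _ "exp (Re b)"]) auto
qed

text \<open>The expansion in the coordinate \<open>log z\<close> is multiplicative along the orbit.\<close>

lemma norm_deriv_funpow_ge:
  assumes f: "entire f" and L: "0 \<le> L"
    and step: "\<And>k. L * norm (f ((f ^^ k) z)) \<le> norm ((f ^^ k) z * deriv f ((f ^^ k) z))"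
  shows "L ^ n * norm ((f ^^ n) z) \<le> norm z * norm (deriv (f ^^ n) z)"
proof (induction n)
  case 0
  show ?case by (simp add: id_def)
next
  case (Suc n)
  have deq: "deriv (f ^^ Suc n) z = deriv f ((f ^^ n) z) * deriv (f ^^ n) z"
    using f entire_funpow[OF f, of n] unfolding entire_def funpow.simps
    by (intro deriv_chain) (auto simp: holomorphic_on_imp_differentiable_at)
  have "L ^ Suc n * norm ((f ^^ Suc n) z) \<le> L ^ n * norm ((f ^^ n) z * deriv f ((f ^^ n) z))"
    using mult_left_mono[OF step[of n], of "L ^ n"] L by (simp add: mult_ac)
  also have "\<dots> \<le> norm z * norm (deriv (f ^^ n) z) * norm (deriv f ((f ^^ n) z))"
    using mult_right_mono[OF Suc, of "norm (deriv f ((f ^^ n) z))"] by (simp add: norm_mult mult_ac)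
  also have "\<dots> = norm z * norm (deriv (f ^^ Suc n) z)"
    by (simp only: deq norm_mult mult_ac)
  finally show ?case .
qed

text \<open>In the Fatou set, the expansion would force an image of a disc about \<open>z\<close> to contain a circle around
  the Julia point \<open>p\<close>. The hypothesis \<open>|f\<^sup>k z| \<ge> 1\<close> bounds \<open>|f\<^sup>n z - p|\<close> by
  \<open>(1 + |p|) |f\<^sup>n z|\<close>, against which the expansion is measured.\<close>

lemma expanding_orbit_in_Julia:
  assumes f: "entire f" "\<not> f constant_on UNIV"
    and simp_conn: "\<not> (\<exists>C\<in>components (Fatou f). \<not> simply_connected C)"
    and p: "p \<in> Julia f"
    and L: "1 < L" and big: "\<And>k. 1 \<le> norm ((f ^^ k) z)"
    and step: "\<And>k. L * norm (f ((f ^^ k) z)) \<le> norm ((f ^^ k) z * deriv f ((f ^^ k) z))"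
  shows "z \<in> Julia f"
proof (rule ccontr)
  assume "z \<notin> Julia f"
  then have "z \<in> Fatou f" by (simp add: Julia_def)
  then obtain \<delta> where \<delta>: "0 < \<delta>" "ball z \<delta> \<subseteq> Fatou f"
    using open_Fatou open_contains_ball by blast
  have z: "norm z > 0" using big[of 0] by auto
  obtain n where n: "48 * (1 + norm p) * norm z / \<delta> < L ^ n"
    using real_arch_pow[OF L] by blast
  let ?w = "(f ^^ n) z"
  have sub: "(f ^^ n) ` ball z \<delta> \<subseteq> Fatou f"
    using \<delta>(2) Fatou_funpow[OF f] by blast
  have "norm (?w - p) \<le> norm ?w + norm p * 1" using norm_triangle_ineq4[of ?w p] by simp
  also have "\<dots> \<le> norm ?w + norm p * norm ?w" using big[of n] by (intro add_left_mono mult_left_mono) auto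
  finally have "norm (?w - p) \<le> norm ?w + norm p * norm ?w" .
  from mult_left_mono[OF this, of "48 * norm z"]
  have "48 * norm (?w - p) * norm z \<le> 48 * (1 + norm p) * norm z * norm ?w"
    by (simp add: algebra_simps)
  also have "\<dots> \<le> \<delta> * L ^ n * norm ?w"
    using n \<delta>(1) by (intro mult_right_mono) (auto simp: field_simps)
  also have "\<dots> \<le> \<delta> * (norm z * norm (deriv (f ^^ n) z))"
    using norm_deriv_funpow_ge[OF f(1) _ step, of n] L \<delta>(1) by (simp add: mult.assoc)
  finally have "48 * norm (?w - p) * norm z \<le> \<delta> * norm (deriv (f ^^ n) z) * norm z" by (simp add: mult_ac)
  then have "48 * norm (?w - p) \<le> \<delta> * norm (deriv (f ^^ n) z)" using z by simp
  moreover have "f ^^ n holomorphic_on ball z \<delta>" using entire_funpow[OF f(1)] holomorphic_on_subset by blast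
  moreover have "p \<notin> (f ^^ n) ` ball z \<delta>" using p sub by (auto simp: Julia_def)
  ultimately obtain r where "r > 0" "sphere p r \<subseteq> (f ^^ n) ` ball z \<delta>"
    using image_contains_circle_around_omitted_value[of "f ^^ n" z \<delta> p] \<delta>(1) by blast
  then show False
    using circle_in_Fatou_imp_multiply_connected[of p f r] p sub simp_conn by (auto simp: Julia_def)
qed

lemma escaping_borel:
  assumes "entire f"
  shows "escaping f \<in> sets borel"
proof -
  have [measurable]: "f ^^ n \<in> borel_measurable borel" for n
    using entire_funpow[OF assms]
    by (intro borel_measurable_continuous_onI holomorphic_on_imp_continuous_on)
  have "filterlim (\<lambda>n. (f ^^ n) z) at_infinity sequentially \<longleftrightarrow>
      (\<forall>N::nat. \<exists>m. \<forall>n\<ge>m. real N \<le> norm ((f ^^ n) z))" for z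
    unfolding filterlim_at_infinity_conv_norm_at_top filterlim_at_top eventually_sequentially
    by (meson order_trans real_arch_simple)
  then have "escaping f = {z. \<forall>N::nat. \<exists>m. \<forall>n\<in>{m..}. real N \<le> norm ((f ^^ n) z)}"
    unfolding escaping_def by (simp add: Ball_def)
  also have "\<dots> \<in> sets borel" by measurable
  finally show ?thesis .
qed

section \<open>The escaping set and its intersection with the Julia set\<close>

theorem theorem1p1:
  fixes f :: "complex \<Rightarrow> complex" and \<rho> \<epsilon> :: real
  assumes "entire f"
    and "\<not> linear_fun f"
    and "growth_order f = ereal \<rho>"
    and "\<epsilon> > 0"
    and "logarea {z \<in> outer_region.
           norm (z * deriv f z / f z) < norm z powr (\<rho> / 2 + \<epsilon>) \<or>
           norm (f z) < (1 + \<epsilon>) * norm z} < \<infinity>"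
  shows "logarea (outer_region - escaping f) < \<infinity> \<and>
    area (escaping f) > 0 \<and>
    (\<not> (\<exists>C \<in> components (Fatou f). \<not> simply_connected C) \<longrightarrow>
       logarea (outer_region - (escaping f \<inter> Julia f)) < \<infinity> \<and>
       area (escaping f \<inter> Julia f) > 0)"
proof -
  note f = assms(1,2) and \<epsilon> = assms(4)
  define E where "E = {z \<in> outer_region.
           norm (z * deriv f z / f z) < norm z powr (\<rho> / 2 + \<epsilon>) \<or>
           norm (f z) < (1 + \<epsilon>) * norm z}"
  have nonconst: "\<not> f constant_on UNIV"
  proof
    assume "f constant_on UNIV"
    then obtain c where "\<And>z. f z = 0 * z + c" by (auto simp: constant_on_def)
    then show False using f(2) unfolding linear_fun_def by blast
  qed
  have \<rho>: "0 \<le> \<rho>" using growth_order_nonneg[OF f(1) nonconst] assms(3) by simp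
  note [measurable] = entire_borel_measurable[OF f(1)]
  have [measurable]: "E \<in> sets borel" unfolding E_def by measurable
  obtain R0 where R0: "1 \<le> R0" "\<And>R B. \<lbrakk>R0 \<le> R; B \<in> sets borel; B \<subseteq> {w. R \<le> norm w}\<rbrakk> \<Longrightarrow>
       logarea {z. R \<le> norm z \<and> norm z powr (\<rho> / 2 + \<epsilon>) \<le> norm (z * deriv f z / f z) \<and> f z \<in> B}
         \<le> ennreal (1 / 2) * logarea B"
    using logarea_pullback_le_half[OF f(1) assms(3) \<rho> \<epsilon>] by blast
  \<comment> \<open>Any bound greater than \<open>1\<close> besides \<open>R0\<close> would do: it makes the expansion factor
      \<open>R powr (\<rho> / 2 + \<epsilon>)\<close> exceed \<open>1\<close>.\<close>
  define R where "R = max R0 2"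
  have R: "R0 \<le> R" "2 \<le> R" by (auto simp: R_def)
  \<comment> \<open>\<open>B n\<close> consists of the points of modulus at least \<open>R\<close> whose orbit enters \<open>E\<close> for the first time at step \<open>n\<close>.\<close>
  define B where "B = rec_nat (E \<inter> {z. R \<le> norm z}) (\<lambda>_ S. {z. R \<le> norm z \<and> z \<notin> E \<and> f z \<in> S})"
  have B_0: "B 0 = E \<inter> {z. R \<le> norm z}"
    and B_Suc: "B (Suc n) = {z. R \<le> norm z \<and> z \<notin> E \<and> f z \<in> B n}" for n
    by (simp_all add: B_def)
  have B_borel [measurable]: "B n \<in> sets borel" for n
  proof (induction n)
    case 0
    show ?case unfolding B_0 by measurable
  next
    case (Suc n)
    note [measurable] = Suc
    show ?case unfolding B_Suc by measurable
  qed
  have B_sub: "B n \<subseteq> {w. R \<le> norm w}" for n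
    by (cases n) (auto simp: B_0 B_Suc)
  have off_E: "norm z powr (\<rho> / 2 + \<epsilon>) \<le> norm (z * deriv f z / f z)" "(1 + \<epsilon>) * norm z \<le> norm (f z)"
    if "R \<le> norm z" "z \<notin> E" for z
    using that R(2) by (auto simp: E_def outer_region_def)
  have B_le: "logarea (B n) \<le> ennreal ((1 / 2) ^ n) * logarea E" for n
  proof (induction n)
    case 0
    show ?case by (simp add: B_0 logarea_mono)
  next
    case (Suc n)
    have "logarea (B (Suc n)) \<le> logarea {z. R \<le> norm z \<and>
        norm z powr (\<rho> / 2 + \<epsilon>) \<le> norm (z * deriv f z / f z) \<and> f z \<in> B n}"
      using off_E by (intro logarea_mono) (auto simp: B_Suc)
    also have "\<dots> \<le> ennreal (1 / 2) * logarea (B n)" using R0(2)[OF R(1) B_borel B_sub] .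
    also have "\<dots> \<le> ennreal (1 / 2) * (ennreal ((1 / 2) ^ n) * logarea E)"
      by (intro mult_left_mono Suc) auto
    also have "\<dots> = ennreal ((1 / 2) ^ Suc n) * logarea E"
      by (subst mult.assoc[symmetric], subst ennreal_mult[symmetric]) auto
    finally show ?case .
  qed
  define Bad where "Bad = (\<Union>n. B n)"
  have [measurable]: "Bad \<in> sets borel" unfolding Bad_def by measurable
  have "logarea Bad \<le> (\<Sum>n. logarea (B n))"
    unfolding Bad_def by (rule logarea_UN_le[OF B_borel])
  also have "\<dots> \<le> (\<Sum>n. ennreal ((1 / 2) ^ n) * logarea E)"
    by (intro suminf_le B_le) auto
  also have "\<dots> = (\<Sum>n. ennreal ((1 / 2) ^ n)) * logarea E" by simp
  also have "(\<Sum>n. ennreal ((1 / 2) ^ n)) = ennreal (\<Sum>n. (1 / 2) ^ n)"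
    by (intro suminf_ennreal2) (auto intro!: summable_geometric)
  also have "ennreal (\<Sum>n. (1 / 2) ^ n) * logarea E < \<infinity>"
    using assms(5) by (simp add: E_def ennreal_mult_less_top)
  finally have Bad_fin: "logarea Bad < \<infinity>" .
  define Good where "Good = {z. R \<le> norm z} - Bad"
  have [measurable]: "Good \<in> sets borel" unfolding Good_def by measurable
  have cofin: "logarea (outer_region - S) < \<infinity>" if "Good \<subseteq> S" for S
  proof -
    have "outer_region - S \<subseteq> (outer_region \<inter> cball 0 R) \<union> Bad"
    proof
      fix z assume z: "z \<in> outer_region - S"
      show "z \<in> (outer_region \<inter> cball 0 R) \<union> Bad"
      proof (cases "R \<le> norm z")
        case True
        then show ?thesis using that z by (auto simp: Good_def)
      qed (use z in simp)
    qed
    then have "logarea (outer_region - S) \<le> logarea ((outer_region \<inter> cball 0 R) \<union> Bad)"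
      by (rule logarea_mono)
    also have "\<dots> \<le> logarea (outer_region \<inter> cball 0 R) + logarea Bad"
      by (intro logarea_Un_le) measurable
    also have "\<dots> < \<infinity>"
      using Bad_fin logarea_outer_bounded[of "outer_region \<inter> cball 0 R"]
      by (auto intro: bounded_subset[OF bounded_cball])
    finally show ?thesis .
  qed
  have Good_orbit: "(f ^^ n) z \<in> Good" if "z \<in> Good" for z n
  proof (induction n)
    case (Suc n)
    let ?w = "(f ^^ n) z"
    have w: "R \<le> norm ?w" "\<And>m. ?w \<notin> B m" using Suc by (auto simp: Good_def Bad_def)
    have nE: "?w \<notin> E" using w(1) w(2)[of 0] by (auto simp: B_0)
    have "norm ?w \<le> (1 + \<epsilon>) * norm ?w" using \<epsilon> by (simp add: distrib_right)
    also have "\<dots> \<le> norm (f ?w)" using off_E(2)[OF w(1) nE] .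
    finally have "norm ?w \<le> norm (f ?w)" .
    moreover have "f ?w \<notin> B m" for m using w(2)[of "Suc m"] w(1) nE by (simp add: B_Suc)
    ultimately show ?case using w(1) by (simp add: Good_def Bad_def)
  qed (use that in simp)
  have Good_E: "R \<le> norm z" "z \<notin> E" if "z \<in> Good" for z
  proof -
    have "R \<le> norm z" "z \<notin> B 0" using that by (auto simp: Good_def Bad_def)
    then show "R \<le> norm z" "z \<notin> E" by (auto simp: B_0)
  qed
  have Good_esc: "Good \<subseteq> escaping f"
  proof
    fix z assume z: "z \<in> Good"
    have ge: "(1 + \<epsilon>) ^ n * norm z \<le> norm ((f ^^ n) z)" for n
    proof (induction n)
      case (Suc n)
      have "(1 + \<epsilon>) ^ Suc n * norm z \<le> (1 + \<epsilon>) * norm ((f ^^ n) z)"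
        using Suc \<epsilon> by (simp add: mult.assoc mult_left_mono)
      also have "\<dots> \<le> norm (f ((f ^^ n) z))"
        using off_E(2) Good_E[OF Good_orbit[OF z]] by blast
      finally show ?case by simp
    qed simp
    have "norm z > 0" using Good_E(1)[OF z] R by linarith
    moreover have "filterlim (\<lambda>n. (1 + \<epsilon>) ^ n) at_top sequentially"
      using filterlim_realpow_sequentially_gt1[of "1 + \<epsilon>"] \<epsilon>
      by (simp add: filterlim_at_infinity_conv_norm_at_top norm_power)
    ultimately have "filterlim (\<lambda>n. (1 + \<epsilon>) ^ n * norm z) at_top sequentially"
      by (intro filterlim_at_top_mult_tendsto_pos[OF tendsto_const])
    then have "filterlim (\<lambda>n. norm ((f ^^ n) z)) at_top sequentially"
      by (rule filterlim_at_top_mono) (use ge in auto)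
    then show "z \<in> escaping f"
      by (simp add: escaping_def filterlim_at_infinity_conv_norm_at_top)
  qed
  have esc_borel: "escaping f \<in> sets borel" by (rule escaping_borel[OF f(1)])
  have 1: "logarea (outer_region - escaping f) < \<infinity>" using cofin[OF Good_esc] .
  have 2: "area (escaping f) > 0" using area_pos_if_cofinite_logarea[OF esc_borel 1] .
  then have "escaping f \<noteq> {}" by (auto simp: area_def)
  then obtain p where p: "p \<in> Julia f" using Julia_nonempty[OF f] by blast
  have "logarea (outer_region - (escaping f \<inter> Julia f)) < \<infinity> \<and> area (escaping f \<inter> Julia f) > 0"
    if sc: "\<not> (\<exists>C \<in> components (Fatou f). \<not> simply_connected C)"
  proof -
    define L where "L = R powr (\<rho> / 2 + \<epsilon>)"
    have L: "1 < L" unfolding L_def using R \<rho> \<epsilon> by (intro gr_one_powr) auto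
    have "Good \<subseteq> Julia f"
    proof
      fix z assume z: "z \<in> Good"
      show "z \<in> Julia f"
      proof (rule expanding_orbit_in_Julia[OF f(1) nonconst sc p L])
        fix k
        let ?w = "(f ^^ k) z"
        have w: "R \<le> norm ?w" "?w \<notin> E" using Good_E[OF Good_orbit[OF z]] by auto
        show w1: "1 \<le> norm ?w" using w R by linarith
        have "0 < (1 + \<epsilon>) * norm ?w" using w1 \<epsilon> by (intro mult_pos_pos) linarith+
        then have nz: "norm (f ?w) > 0" using off_E(2)[OF w] by linarith
        have "L \<le> norm ?w powr (\<rho> / 2 + \<epsilon>)"
          unfolding L_def using w R \<rho> \<epsilon> by (intro powr_mono2) auto
        also have "\<dots> \<le> norm (?w * deriv f ?w / f ?w)" using off_E(1)[OF w] .
        finally show "L * norm (f ?w) \<le> norm (?w * deriv f ?w)"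
          using nz by (simp add: norm_divide field_simps)
      qed
    qed
    then have "Good \<subseteq> escaping f \<inter> Julia f" using Good_esc by simp
    from cofin[OF this] have 3: "logarea (outer_region - (escaping f \<inter> Julia f)) < \<infinity>" .
    have "Julia f \<in> sets borel" using open_Fatou[of f] by (simp add: Julia_def)
    then show ?thesis using 3 esc_borel by (auto intro: area_pos_if_cofinite_logarea)
  qed
  then show ?thesis using 1 2 by blast
qed

end
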